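(* Let $X\in\mathbb{R}^{n\times p}$ be a fixed design matrix, $\mu\in\mathbb{R}^n$ a fixed unknown vector, and $Y=\mu+\epsilon$ with $\epsilon\sim N(0,\Sigma)$, where $\Sigma$ is a known covariance matrix. Let $Z\sim N(0,\Sigma)$ be independent of $Y$, let $\tau>0$, and set $f(Y)=Y+\tau Z$, $g(Y)=Y-\frac1\tau Z$. Let $M\subseteq[p]$ be a model selected on the basis of $f(Y)$ (a function of $f(Y)$), let $X_M$ be the submatrix of $X$ consisting of the columns indexed by $M$, with $X_M^TX_M$ invertible, and define $$\widehat\beta(M)=\arg\min_{\widetilde\beta}\|g(Y)-X_M\widetilde\beta\|^2=(X_M^TX_M)^{-1}X_M^Tg(Y),$$ $$\beta^*(M)=\arg\min_{\widetilde\beta}\mathbb{E}\left[\|Y-X_M\widetilde\beta\|^2\right]=(X_M^TX_M)^{-1}X_M^T\mu,$$ where in the definition of $\beta^*(M)$ the matrix $X_M$ is treated as fixed. Then, conditionally on $f(Y)$ (hence with $M$ fixed), $$\widehat\beta(M)\sim N\left(\beta^*(M),\,(1+\tau^{-2})(X_M^TX_M)^{-1}X_M^T\Sigma X_M(X_M^TX_M)^{-1}\right).$$ Furthermore, for each $k\in\{1,\dots,|M|\}$, the interval $$\widehat\beta^k(M)\pm z_{\alpha/2}\sqrt{(1+\tau^{-2})\left[(X_M^TX_M)^{-1}X_M^T\Sigma X_M(X_M^TX_M)^{-1}\right]_{kk}}$$ is a $1-\alpha$ confidence interval for the $k$th element of $\beta^*(M)$.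
   Context: $\alpha\in(0,1)$ and $z_{\alpha/2}$ is the upper $\alpha/2$ quantile of the standard normal distribution. $\widehat\beta^k(M)$ is the $k$th coordinate of $\widehat\beta(M)$. "$1-\alpha$ confidence interval" means that the interval contains the $k$th element of $\beta^*(M)$ with probability $1-\alpha$ (conditionally on $f(Y)$). $[n]=\{1,\dots,n\}$.
   Formalization: Coverage exactly 1-α is stated when the kth diagonal variance entry is positive (proved for positive definite Σ); if that entry is 0 (possible only for singular Σ), coverage is only claimed to be at least 1-α, since the interval is then a point with coverage 1. *)

theory Defs
  imports
    "HOL-Probability.Probability"
    "Jordan_Normal_Form.Gauss_Jordan_Elimination"
    "Jordan_Normal_Form.DL_Submatrix"
begin

unbundle no inner_syntax
unbundle no vec_syntax
hide_type (open) Finite_Cartesian_Product.vec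
hide_const (open) Finite_Cartesian_Product.vec

section \<open>Random vectors\<close>

text \<open>
  The selected model, and hence the length of the fitted coefficient vector, is random. So all
  real vectors, of every dimension, form one measurable space: the disjoint union of the Borel
  spaces of dimension 0, 1, 2, and so on. The orthants below generate it; in particular every
  \<^term>\<open>carrier_vec d\<close>, a countable union of orthants, is measurable.
\<close>

definition vec_borel :: "real vec measure" where
  "vec_borel = sigma UNIV {{v \<in> carrier_vec d. \<forall>i<d. v $ i \<le> c $ i} | d c. c \<in> carrier_vec d}"

definition random_vec :: "'w measure \<Rightarrow> nat \<Rightarrow> ('w \<Rightarrow> real vec) \<Rightarrow> bool" where
  "random_vec P d W \<longleftrightarrow> W \<in> measurable P vec_borel \<and> (\<forall>\<omega>\<in>space P. W \<omega> \<in> carrier_vec d)"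

section \<open>Normal distributions\<close>

definition covariance_mat :: "nat \<Rightarrow> real mat \<Rightarrow> bool" where
  "covariance_mat d S \<longleftrightarrow> S \<in> carrier_mat d d \<and> transpose_mat S = S \<and>
     (\<forall>v\<in>carrier_vec d. v \<bullet> (S *\<^sub>v v) \<ge> 0)"

definition pos_def_mat :: "nat \<Rightarrow> real mat \<Rightarrow> bool" where
  "pos_def_mat d S \<longleftrightarrow> S \<in> carrier_mat d d \<and> transpose_mat S = S \<and>
     (\<forall>v\<in>carrier_vec d. v \<noteq> 0\<^sub>v d \<longrightarrow> v \<bullet> (S *\<^sub>v v) > 0)"

text \<open>The second parameter is the variance; variance 0 gives a point mass.\<close>

definition normal_law :: "real \<Rightarrow> real \<Rightarrow> real measure" where
  "normal_law m v = (if v = 0 then return borel m else density lborel (normal_density m (sqrt v)))"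

text \<open>
  A law on d-dimensional space is multivariate normal if all its linear forms are univariate
  normal. The covariance matrix may be singular.
\<close>

definition mvn_law :: "nat \<Rightarrow> real vec measure \<Rightarrow> real vec \<Rightarrow> real mat \<Rightarrow> bool" where
  "mvn_law d \<nu> m S \<longleftrightarrow>
     m \<in> carrier_vec d \<and> covariance_mat d S \<and>
     prob_space \<nu> \<and> sets \<nu> = sets vec_borel \<and> (AE v in \<nu>. v \<in> carrier_vec d) \<and>
     (\<forall>a\<in>carrier_vec d. distr \<nu> borel (\<lambda>v. a \<bullet> v) = normal_law (a \<bullet> m) (a \<bullet> (S *\<^sub>v a)))"

definition normal_upper_quantile :: "real \<Rightarrow> real" where
  "normal_upper_quantile q = (THE z. measure (density lborel std_normal_density) {z<..} = q)"

section \<open>Conditioning\<close>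

definition generated_by :: "'w measure \<Rightarrow> ('w \<Rightarrow> 'b) \<Rightarrow> 'b measure \<Rightarrow> 'w measure" where
  "generated_by P U N = vimage_algebra (space P) U N"

definition cond_probability :: "'w measure \<Rightarrow> 'w measure \<Rightarrow> 'w set \<Rightarrow> 'w \<Rightarrow> real" where
  "cond_probability P F E = real_cond_exp P F (indicator E)"

definition regular_cond_law ::
  "'w measure \<Rightarrow> 'w measure \<Rightarrow> ('w \<Rightarrow> 'b) \<Rightarrow> 'b measure \<Rightarrow> ('w \<Rightarrow> 'b measure) \<Rightarrow> bool" where
  "regular_cond_law P F W N \<kappa> \<longleftrightarrow>
     W \<in> measurable P N \<and> \<kappa> \<in> measurable F (prob_algebra N) \<and>
     (\<forall>B\<in>sets N. AE \<omega> in P. cond_probability P F (W -` B \<inter> space P) \<omega> = measure (\<kappa> \<omega>) B)"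

section \<open>Least squares on selected columns\<close>

text \<open>
  Columns are numbered from 0, so a model is a subset M of \<^term>\<open>{..<p}\<close>; the selected columns
  keep their order.
\<close>

definition cols_of :: "real mat \<Rightarrow> nat set \<Rightarrow> real mat" where
  "cols_of X M = submatrix X UNIV M"

definition gram :: "real mat \<Rightarrow> nat set \<Rightarrow> real mat" where
  "gram X M = transpose_mat (cols_of X M) * cols_of X M"

definition inv_mat :: "real mat \<Rightarrow> real mat" where
  "inv_mat A = the (mat_inverse A)"

definition sq_norm :: "real vec \<Rightarrow> real" where
  "sq_norm v = v \<bullet> v"

definition beta_hat :: "real mat \<Rightarrow> nat set \<Rightarrow> real vec \<Rightarrow> real vec" where
  "beta_hat X M y = arg_min_on (\<lambda>b. sq_norm (y - cols_of X M *\<^sub>v b)) (carrier_vec (card M))"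

definition beta_star :: "'w measure \<Rightarrow> ('w \<Rightarrow> real vec) \<Rightarrow> real mat \<Rightarrow> nat set \<Rightarrow> real vec" where
  "beta_star P Y X M =
     arg_min_on (\<lambda>b. \<integral>\<omega>. sq_norm (Y \<omega> - cols_of X M *\<^sub>v b) \<partial>P) (carrier_vec (card M))"

definition ls_solution :: "real mat \<Rightarrow> nat set \<Rightarrow> real vec \<Rightarrow> real vec" where
  "ls_solution X M y = (inv_mat (gram X M) * transpose_mat (cols_of X M)) *\<^sub>v y"

definition sandwich :: "real mat \<Rightarrow> nat set \<Rightarrow> real mat \<Rightarrow> real mat" where
  "sandwich X M S =
     inv_mat (gram X M) * transpose_mat (cols_of X M) * S * cols_of X M * inv_mat (gram X M)"

definition fission_var :: "real mat \<Rightarrow> nat set \<Rightarrow> real mat \<Rightarrow> real \<Rightarrow> real mat" where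
  "fission_var X M S \<tau> = (1 + 1 / \<tau>\<^sup>2) \<cdot>\<^sub>m sandwich X M S"

end

theory Submission
  imports Defs
begin

text \<open>
  For f = Y + tau Z and g = Y - Z / tau, every linear form a f + b g splits into a linear form of Y
  and one of Z, and the covariance terms mixing a and b cancel. Hence the joint characteristic
  function of (f, g) is a product, and since characteristic functions determine laws, g is
  independent of f, with normal law of mean mu and covariance (1 + 1 / tau^2) Sigma. Conditioning on
  f therefore freezes the selected model and leaves the law of g unchanged; least squares is a linear
  image of g, which gives the conditional law and, coordinatewise, the coverage.
\<close>

section \<open>Measurability of random vectors\<close>

text \<open>\<open>Sigma\<close> may be singular, so f and g need not have densities and
  independence cannot be read off a factored density; hence the detour through characteristic
  functions. \<open>Levy_uniqueness\<close> compares laws on the real line, while independence of f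
  and g concerns 2n coordinates. The gap is closed by comparing the pair (f, g) on \<open>P\<close>
  with independent copies on the product space: frequencies are exchanged for indicators one
  coordinate at a time, until the probabilities of all orthants agree. Orthants are stable under
  intersection, so they settle independence. The factor 1 + 1/\<tau>^2 is the variance of Y -
  Z/\<tau> relative to \<open>Sigma\<close>. Conditioning stays elementary because there are only
  finitely many models: every event splits into finitely many pieces, one for each selected model.
  Singularity also shapes the coverage claim: where a diagonal entry of the covariance vanishes, the
  interval shrinks to a point and covers with probability 1 instead of 1 - \<alpha>.\<close>

lemma space_vec_borel [simp]: "space vec_borel = UNIV"
  by (simp add: vec_borel_def)

lemma orthant_in_vec_borel:
  assumes "c \<in> carrier_vec d"
  shows "{v \<in> carrier_vec d. \<forall>i<d. v $ i \<le> c $ i} \<in> sets vec_borel"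
  unfolding vec_borel_def using assms by (subst sets_measure_of) (auto intro!: sigma_sets.Basic)

text \<open>An orthant bounds every coordinate. Letting the bounds on the other coordinates run
  through the naturals exhausts the half space; the sum of absolute values shows that one natural
  number bounds all coordinates of a vector.\<close>

lemma half_space_in_vec_borel:
  assumes "i < d"
  shows "{v \<in> carrier_vec d. v $ i \<le> c} \<in> sets vec_borel"
proof -
  define b where "b N = vec d (\<lambda>j. if j = i then c else real N)" for N :: nat
  have "{v \<in> carrier_vec d. v $ i \<le> c} = (\<Union>N. {v \<in> carrier_vec d. \<forall>j<d. v $ j \<le> b N $ j})"
  proof (intro equalityI subsetI)
    fix v assume v: "v \<in> {v \<in> carrier_vec d. v $ i \<le> c}"
    obtain N :: nat where N: "(\<Sum>j<d. \<bar>v $ j\<bar>) \<le> N"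
      using real_arch_simple by blast
    have "v $ j \<le> N" if "j < d" for j
      using member_le_sum[of j "{..<d}" "\<lambda>j. \<bar>v $ j\<bar>"] that N by auto
    with v have "v \<in> {v \<in> carrier_vec d. \<forall>j<d. v $ j \<le> b N $ j}"
      by (auto simp: b_def)
    then show "v \<in> (\<Union>N. {v \<in> carrier_vec d. \<forall>j<d. v $ j \<le> b N $ j})" by (rule UN_I[OF UNIV_I])
  next
    fix v assume "v \<in> (\<Union>N. {v \<in> carrier_vec d. \<forall>j<d. v $ j \<le> b N $ j})"
    then obtain N where "v \<in> carrier_vec d" "v $ i \<le> b N $ i" using assms by blast
    then show "v \<in> {v \<in> carrier_vec d. v $ i \<le> c}" using assms by (simp add: b_def)
  qed
  also have "\<dots> \<in> sets vec_borel"
    by (intro sets.countable_UN image_subsetI orthant_in_vec_borel) (simp add: b_def)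
  finally show ?thesis .
qed

lemma carrier_vec_in_vec_borel [measurable, simp]: "carrier_vec d \<in> sets vec_borel"
\<comment> \<open>Dimension 0 has no coordinate to bound, hence no half space; there the one
  orthant, with its empty condition, is the whole carrier.\<close>
proof (cases "d = 0")
  case True
  then show ?thesis using orthant_in_vec_borel[of "0\<^sub>v 0" 0] by simp
next
  case False
  have "carrier_vec d = (\<Union>N::nat. {v \<in> carrier_vec d. v $ 0 \<le> real N})"
    using real_arch_simple by auto
  also have "\<dots> \<in> sets vec_borel"
    using half_space_in_vec_borel[of 0 d] False by auto
  finally show ?thesis .
qed

lemma measurable_dim_vec [measurable]: "dim_vec \<in> measurable vec_borel (count_space UNIV)"
proof -
  have "dim_vec -` {d} \<inter> space vec_borel = (carrier_vec d :: real vec set)" for d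
    unfolding carrier_vec_def by auto
  then show ?thesis
    by (subst measurable_count_space_eq2_countable) simp_all
qed

text \<open>An index beyond the dimension returns a junk value that depends on the dimension only.\<close>

lemma vec_index_beyond:
  assumes "v \<in> carrier_vec d" "w \<in> carrier_vec d" "d \<le> i"
  shows "v $ i = w $ i"
  using assms unfolding carrier_vec_def by transfer (auto simp: mk_vec_def)

text \<open>The sublevel set is cut along the dimension d: a half space if i < d, and otherwise all
  or nothing, since the junk value is constant on \<open>carrier_vec d\<close>.\<close>

lemma measurable_vec_index [measurable]: "(\<lambda>v. v $ i) \<in> borel_measurable vec_borel"
proof (rule borel_measurable_iff_le[THEN iffD2], intro allI)
  fix c :: real
  have "{v \<in> carrier_vec d. v $ i \<le> c} \<in> sets vec_borel" for d
  proof (cases "i < d")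
    case False
    moreover define r :: real where "r = 0\<^sub>v d $ i"
    ultimately have "v $ i = r" if "v \<in> carrier_vec d" for v
      using that vec_index_beyond[of v d "0\<^sub>v d" i] by simp
    then have "{v \<in> carrier_vec d. v $ i \<le> c} = (if r \<le> c then carrier_vec d else {})"
      by auto
    then show ?thesis by simp
  qed (rule half_space_in_vec_borel)
  then have "(\<Union>d. {v \<in> carrier_vec d. v $ i \<le> c}) \<in> sets vec_borel" by blast
  also have "(\<Union>d. {v \<in> carrier_vec d. v $ i \<le> c}) = {v \<in> space vec_borel. v $ i \<le> c}"
    unfolding carrier_vec_def by auto
  finally show "{v \<in> space vec_borel. v $ i \<le> c} \<in> sets vec_borel" .
qed

text \<open>The number of summands is \<open>dim_vec v\<close> and varies with v, so the sum is
  treated separately on each of the countably many dimensions.\<close>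

lemma measurable_scalar_prod [measurable]: "(\<lambda>v. a \<bullet> v) \<in> borel_measurable vec_borel"
  unfolding scalar_prod_def
  by (rule measurable_compose_countable[OF _ measurable_dim_vec]) measurable

text \<open>It suffices to test orthants, and those of a dimension other than d have empty
  preimage.\<close>

lemma measurable_into_vec_borel:
  assumes W: "\<And>\<omega>. \<omega> \<in> space N \<Longrightarrow> W \<omega> \<in> carrier_vec d"
    and m: "\<And>i. i < d \<Longrightarrow> (\<lambda>\<omega>. W \<omega> $ i) \<in> borel_measurable N"
  shows "W \<in> measurable N vec_borel"
  unfolding vec_borel_def
proof (rule measurable_measure_of, safe)
  fix d' and c :: "real vec" assume "c \<in> carrier_vec d'"
  have "W -` {v \<in> carrier_vec d'. \<forall>i<d'. v $ i \<le> c $ i} \<inter> space N =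
    (if d' = d then {\<omega> \<in> space N. \<forall>i\<in>{..<d}. W \<omega> $ i \<le> c $ i} else {})"
    using W unfolding carrier_vec_def by auto
  moreover have "{\<omega> \<in> space N. \<forall>i\<in>{..<d}. W \<omega> $ i \<le> c $ i} \<in> sets N"
    by (rule sets.sets_Collect_finite_All) (use m in auto)
  ultimately show "W -` {v \<in> carrier_vec d'. \<forall>i<d'. v $ i \<le> c $ i} \<inter> space N \<in> sets N"
    by simp
qed simp_all

lemma random_vecI:
  assumes "\<And>\<omega>. \<omega> \<in> space P \<Longrightarrow> W \<omega> \<in> carrier_vec d"
    and "\<And>i. i < d \<Longrightarrow> (\<lambda>\<omega>. W \<omega> $ i) \<in> borel_measurable P"
  shows "random_vec P d W"
  unfolding random_vec_def using measurable_into_vec_borel[of P W d] assms by simp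

lemma random_vec_measurable: "random_vec P d W \<Longrightarrow> W \<in> measurable P vec_borel"
  by (simp add: random_vec_def)

lemma random_vec_carrier: "random_vec P d W \<Longrightarrow> \<omega> \<in> space P \<Longrightarrow> W \<omega> \<in> carrier_vec d"
  by (simp add: random_vec_def)

lemma random_vec_index: "random_vec P d W \<Longrightarrow> (\<lambda>\<omega>. W \<omega> $ i) \<in> borel_measurable P"
  using measurable_compose[OF random_vec_measurable measurable_vec_index] .

lemma random_vec_scalar_prod: "random_vec P d W \<Longrightarrow> (\<lambda>\<omega>. a \<bullet> W \<omega>) \<in> borel_measurable P"
  using measurable_compose[OF random_vec_measurable measurable_scalar_prod] .

lemma random_vec_const_add:
  assumes "random_vec P d W" "c \<in> carrier_vec d"
  shows "random_vec P d (\<lambda>\<omega>. c + W \<omega>)"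
proof (rule random_vecI)
  fix i assume "i < d"
  then have "(\<lambda>\<omega>. c $ i + W \<omega> $ i) \<in> borel_measurable P"
    using random_vec_index[OF assms(1)] by measurable
  then show "(\<lambda>\<omega>. (c + W \<omega>) $ i) \<in> borel_measurable P"
    by (subst measurable_cong) (use \<open>i < d\<close> carrier_vecD[OF random_vec_carrier[OF assms(1)]] in auto)
qed (use assms(2) in \<open>auto intro!: add_carrier_vec random_vec_carrier[OF assms(1)]\<close>)

lemma random_vec_add_smult:
  assumes "random_vec P d V" "random_vec P d W"
  shows "random_vec P d (\<lambda>\<omega>. V \<omega> + r \<cdot>\<^sub>v W \<omega>)"
proof (rule random_vecI)
  fix i assume "i < d"
  have "(\<lambda>\<omega>. V \<omega> $ i + r * W \<omega> $ i) \<in> borel_measurable P"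
    using random_vec_index[OF assms(1)] random_vec_index[OF assms(2)] by measurable
  then show "(\<lambda>\<omega>. (V \<omega> + r \<cdot>\<^sub>v W \<omega>) $ i) \<in> borel_measurable P"
    by (subst measurable_cong)
      (use \<open>i < d\<close> carrier_vecD[OF random_vec_carrier[OF assms(1)]]
        carrier_vecD[OF random_vec_carrier[OF assms(2)]] in auto)
qed (auto intro!: add_carrier_vec random_vec_carrier[OF assms(1)] random_vec_carrier[OF assms(2)])

section \<open>Characteristic functions determine laws\<close>

text \<open>These identities convert the weights cos and sin into shifts of the frequency.\<close>

lemma iexp_sums:
  "iexp (x + s) + iexp (x - s) = 2 * complex_of_real (cos s) * iexp x"
  "iexp (x + s) - iexp (x - s) = 2 * \<i> * complex_of_real (sin s) * iexp x"
  unfolding cis_conv_exp[symmetric]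
  by (simp_all add: complex_eq_iff cos_add sin_add cos_diff sin_diff algebra_simps)

text \<open>Dividing the weight by its total mass c yields a probability law, the kind of object
  that Levy's theorem compares. The bound C secures integrability.\<close>

lemma weighted_law_char:
  fixes U w :: "'a \<Rightarrow> real"
  assumes N: "finite_measure N"
    and [measurable]: "U \<in> borel_measurable N" "w \<in> borel_measurable N"
    and w: "\<And>x. x \<in> space N \<Longrightarrow> 0 \<le> w x \<and> w x \<le> C"
    and c: "(\<integral>x. w x \<partial>N) = c" "c > 0"
  defines "D \<equiv> distr (density N (\<lambda>x. ennreal (w x / c))) borel U"
  shows "real_distribution D"
    and "char D t = (\<integral>x. w x *\<^sub>R iexp (t * U x) \<partial>N) / c"
    and "A \<in> sets borel \<Longrightarrow> measure D A = (\<integral>x. w x * indicator A (U x) \<partial>N) / c"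
proof -
  interpret finite_measure N by fact
  have int: "integrable N w"
    by (rule integrable_const_bound[of _ C]) (use w in auto)
  have wc: "AE x in N. 0 \<le> w x / c" using w c by auto
  have "emeasure (density N (\<lambda>x. ennreal (w x / c))) (space N) = (\<integral>\<^sup>+x. ennreal (w x / c) \<partial>N)"
    by (subst emeasure_density) (auto intro!: nn_integral_cong)
  also have "\<dots> = ennreal (\<integral>x. w x / c \<partial>N)"
    by (rule nn_integral_eq_integral) (use int wc in auto)
  also have "\<dots> = 1" using c by simp
  finally have ps: "prob_space (density N (\<lambda>x. ennreal (w x / c)))"
    by (intro prob_spaceI) simp
  then show rd: "real_distribution D"
    unfolding D_def by (rule prob_space.real_distribution_distr) simp
  have "char D t = (\<integral>x. (w x / c) *\<^sub>R iexp (t * U x) \<partial>N)"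
    unfolding char_def D_def using wc
    by (subst integral_distr, simp, simp, subst integral_density) auto
  also have "\<dots> = (\<integral>x. (w x *\<^sub>R iexp (t * U x)) / c \<partial>N)"
    by (simp add: scaleR_conv_of_real)
  finally show "char D t = (\<integral>x. w x *\<^sub>R iexp (t * U x) \<partial>N) / c"
    by simp
  assume A: "A \<in> sets borel"
  then have [measurable]: "(\<lambda>x. indicator A (U x) :: real) \<in> borel_measurable N" by measurable
  interpret D: real_distribution D by (rule rd)
  have "measure D A = (\<integral>x. indicator A x \<partial>D)"
    using A by (simp add: D_def)
  also have "\<dots> = (\<integral>x. (w x / c) *\<^sub>R indicator A (U x) \<partial>N)"
    unfolding D_def using wc A by (subst integral_distr, simp, simp, subst integral_density) auto
  finally show "measure D A = (\<integral>x. w x * indicator A (U x) \<partial>N) / c"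
    by simp
qed

lemma weighted_law_unique:
  fixes U w1 :: "'a \<Rightarrow> real" and V w2 :: "'b \<Rightarrow> real"
  assumes N: "finite_measure N1" "finite_measure N2"
    and m [measurable]: "U \<in> borel_measurable N1" "w1 \<in> borel_measurable N1"
      "V \<in> borel_measurable N2" "w2 \<in> borel_measurable N2"
    and w1: "\<And>x. x \<in> space N1 \<Longrightarrow> 0 \<le> w1 x \<and> w1 x \<le> C"
    and w2: "\<And>x. x \<in> space N2 \<Longrightarrow> 0 \<le> w2 x \<and> w2 x \<le> C"
    and eq: "\<And>t. (\<integral>x. w1 x *\<^sub>R iexp (t * U x) \<partial>N1) = (\<integral>x. w2 x *\<^sub>R iexp (t * V x) \<partial>N2)"
    and A: "A \<in> sets borel"
  shows "(\<integral>x. w1 x * indicator A (U x) \<partial>N1) = (\<integral>x. w2 x * indicator A (V x) \<partial>N2)"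
proof -
  interpret N1: finite_measure N1 by fact
  interpret N2: finite_measure N2 by fact
  define c where "c = (\<integral>x. w1 x \<partial>N1)"
  \<comment> \<open>Frequency 0 turns the hypothesis into equality of the total masses, so both
    sides share one normalising constant.\<close>
  have c2: "(\<integral>x. w2 x \<partial>N2) = c"
  proof -
    have "complex_of_real (\<integral>x. w1 x \<partial>N1) = complex_of_real (\<integral>x. w2 x \<partial>N2)"
      using eq[of 0] by (simp add: scaleR_conv_of_real)
    then show ?thesis by (simp add: c_def)
  qed
  have "0 \<le> c" unfolding c_def by (rule integral_nonneg_AE) (use w1 in auto)
  show ?thesis
  proof (cases "c = 0")
    \<comment> \<open>Mass zero cannot be normalised, but then both weights vanish almost everywhere
      and both integrals are 0.\<close>
    case True
    have "integrable N1 w1" "integrable N2 w2"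
      using w1 w2 by (auto intro!: N1.integrable_const_bound[of _ C] N2.integrable_const_bound[of _ C])
    then have "AE x in N1. w1 x = 0" "AE x in N2. w2 x = 0"
      using integral_nonneg_eq_0_iff_AE[of N1 w1] integral_nonneg_eq_0_iff_AE[of N2 w2] w1 w2 True c2
      by (auto simp: c_def)
    then have "(\<integral>x. w1 x * indicator A (U x) \<partial>N1) = 0" "(\<integral>x. w2 x * indicator A (V x) \<partial>N2) = 0"
      by (auto intro!: integral_eq_zero_AE)
    then show ?thesis by simp
  next
    case False
    with \<open>0 \<le> c\<close> have "c > 0" by simp
    note L1 = weighted_law_char[OF N(1) m(1,2) w1 c_def[symmetric] \<open>c > 0\<close>]
    note L2 = weighted_law_char[OF N(2) m(3,4) w2 c2 \<open>c > 0\<close>]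
    have "char (distr (density N1 (\<lambda>x. ennreal (w1 x / c))) borel U) t =
        char (distr (density N2 (\<lambda>x. ennreal (w2 x / c))) borel V) t" for t
      by (simp only: L1(2) L2(2) eq)
    then have "distr (density N1 (\<lambda>x. ennreal (w1 x / c))) borel U =
          distr (density N2 (\<lambda>x. ennreal (w2 x / c))) borel V"
      by (intro Levy_uniqueness[OF L1(1) L2(1)] ext)
    then show ?thesis using L1(3)[OF _ A] L2(3)[OF _ A] \<open>c > 0\<close> by simp
  qed
qed

text \<open>
  The frequencies are traded for indicators one coordinate at a time. Levy's theorem needs a
  nonnegative weight, so the oscillating factor of the remaining coordinates enters through the
  weights 1 + cos and 1 + sin.
\<close>

lemma char_determines_boxes_step:
  fixes U W I1 :: "'a \<Rightarrow> real" and V T I2 :: "'b \<Rightarrow> real"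
  assumes N: "finite_measure N1" "finite_measure N2"
    and m [measurable]: "U \<in> borel_measurable N1" "W \<in> borel_measurable N1" "I1 \<in> borel_measurable N1"
      "V \<in> borel_measurable N2" "T \<in> borel_measurable N2" "I2 \<in> borel_measurable N2"
    and I1: "\<And>x. 0 \<le> I1 x \<and> I1 x \<le> 1" and I2: "\<And>x. 0 \<le> I2 x \<and> I2 x \<le> 1"
    and eq: "\<And>t s. s \<in> {-1,0,1} \<Longrightarrow> (\<integral>x. I1 x *\<^sub>R iexp (t * U x + s * W x) \<partial>N1) =
      (\<integral>x. I2 x *\<^sub>R iexp (t * V x + s * T x) \<partial>N2)"
    and A [measurable]: "A \<in> sets borel"
  shows "(\<integral>x. (I1 x * indicator A (U x)) *\<^sub>R iexp (W x) \<partial>N1) =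
    (\<integral>x. (I2 x * indicator A (V x)) *\<^sub>R iexp (T x) \<partial>N2)"
proof -
  interpret N1: finite_measure N1 by fact
  interpret N2: finite_measure N2 by fact
  have int1: "integrable N1 (\<lambda>x. I1 x *\<^sub>R iexp (f x))"
    if [measurable]: "f \<in> borel_measurable N1" for f :: "'a \<Rightarrow> real"
    by (rule N1.integrable_const_bound[of _ 1]) (use I1 in auto)
  have int2: "integrable N2 (\<lambda>x. I2 x *\<^sub>R iexp (f x))"
    if [measurable]: "f \<in> borel_measurable N2" for f :: "'b \<Rightarrow> real"
    by (rule N2.integrable_const_bound[of _ 1]) (use I2 in auto)
  have eq0: "(\<integral>x. I1 x *\<^sub>R iexp (t * U x) \<partial>N1) = (\<integral>x. I2 x *\<^sub>R iexp (t * V x) \<partial>N2)" for t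
    using eq[of 0 t] by simp
  have eq1: "(\<integral>x. I1 x *\<^sub>R iexp (t * U x + W x) \<partial>N1) = (\<integral>x. I2 x *\<^sub>R iexp (t * V x + T x) \<partial>N2)" for t
    using eq[of 1 t] by simp
  have eq2: "(\<integral>x. I1 x *\<^sub>R iexp (t * U x - W x) \<partial>N1) = (\<integral>x. I2 x *\<^sub>R iexp (t * V x - T x) \<partial>N2)" for t
    using eq[of "-1" t] by simp
  \<comment> \<open>\<open>h\<close> and \<open>k\<close> are the coefficients in Euler's formulas
    for cos and sin. Through them the weights 1 + cos b and 1 + sin b become combinations of the
    frequencies a, a + b and a - b, which is why the hypothesis is needed for s = 0, 1 and
    -1.\<close>
  define h :: complex where "h = 1 / 2"
  define k :: complex where "k = 1 / (2 * \<i>)"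
  have cosw: "(I * (1 + cos b)) *\<^sub>R iexp a = I *\<^sub>R iexp a +
      h * (I *\<^sub>R iexp (a + b) + I *\<^sub>R iexp (a - b))" for I a b :: real
  proof -
    have "h * (I *\<^sub>R iexp (a + b) + I *\<^sub>R iexp (a - b)) =
      h * (of_real I * (iexp (a + b) + iexp (a - b)))"
      by (simp add: scaleR_conv_of_real algebra_simps)
    also have "\<dots> = of_real I * of_real (cos b) * iexp a"
      unfolding iexp_sums h_def by simp
    finally show ?thesis by (simp add: scaleR_conv_of_real algebra_simps)
  qed
  have sinw: "(I * (1 + sin b)) *\<^sub>R iexp a = I *\<^sub>R iexp a +
      k * (I *\<^sub>R iexp (a + b) - I *\<^sub>R iexp (a - b))" for I a b :: real
  proof -
    have "k * (I *\<^sub>R iexp (a + b) - I *\<^sub>R iexp (a - b)) =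
      k * (of_real I * (iexp (a + b) - iexp (a - b)))"
      by (simp add: scaleR_conv_of_real algebra_simps)
    also have "\<dots> = of_real I * of_real (sin b) * iexp a"
      unfolding iexp_sums k_def by (simp add: field_simps)
    finally show ?thesis by (simp add: scaleR_conv_of_real algebra_simps)
  qed
  \<comment> \<open>The plain weight is compared as well, in order to subtract the summand 1 from 1
    + cos and 1 + sin afterwards.\<close>
  have b0: "(\<integral>x. I1 x * indicator A (U x) \<partial>N1) = (\<integral>x. I2 x * indicator A (V x) \<partial>N2)"
    by (rule weighted_law_unique[OF N, where C = 1]) (use I1 I2 eq0 in auto)
  have le2: "0 \<le> I * (1 + r) \<and> I * (1 + r) \<le> 2"
    if "0 \<le> I \<and> I \<le> 1" "-1 \<le> r" "r \<le> 1" for I r :: real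
    using that mult_mono[of I 1 "1 + r" 2] by auto
  have bc: "(\<integral>x. (I1 x * (1 + cos (W x))) * indicator A (U x) \<partial>N1) =
    (\<integral>x. (I2 x * (1 + cos (T x))) * indicator A (V x) \<partial>N2)"
  proof (rule weighted_law_unique[OF N, where C = 2])
    show "(\<integral>x. (I1 x * (1 + cos (W x))) *\<^sub>R iexp (t * U x) \<partial>N1) =
      (\<integral>x. (I2 x * (1 + cos (T x))) *\<^sub>R iexp (t * V x) \<partial>N2)" for t
      unfolding cosw
      by (simp add: int1 int2 eq0 eq1 eq2 del: of_real_add of_real_mult of_real_diff)
    show "0 \<le> I1 x * (1 + cos (W x)) \<and> I1 x * (1 + cos (W x)) \<le> 2" for x
      by (rule le2) (simp_all add: I1)
    show "0 \<le> I2 x * (1 + cos (T x)) \<and> I2 x * (1 + cos (T x)) \<le> 2" for x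
      by (rule le2) (simp_all add: I2)
  qed measurable
  have bs: "(\<integral>x. (I1 x * (1 + sin (W x))) * indicator A (U x) \<partial>N1) =
    (\<integral>x. (I2 x * (1 + sin (T x))) * indicator A (V x) \<partial>N2)"
  proof (rule weighted_law_unique[OF N, where C = 2])
    show "(\<integral>x. (I1 x * (1 + sin (W x))) *\<^sub>R iexp (t * U x) \<partial>N1) =
      (\<integral>x. (I2 x * (1 + sin (T x))) *\<^sub>R iexp (t * V x) \<partial>N2)" for t
      unfolding sinw
      by (simp add: int1 int2 eq0 eq1 eq2 del: of_real_add of_real_mult of_real_diff)
    show "0 \<le> I1 x * (1 + sin (W x)) \<and> I1 x * (1 + sin (W x)) \<le> 2" for x
      by (rule le2) (simp_all add: I1)
    show "0 \<le> I2 x * (1 + sin (T x)) \<and> I2 x * (1 + sin (T x)) \<le> 2" for x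
      by (rule le2) (simp_all add: I2)
  qed measurable
  have J1: "integrable N1 (\<lambda>x. I1 x * indicator A (U x) * g x)"
    if [measurable]: "g \<in> borel_measurable N1" and "\<And>x. \<bar>g x\<bar> \<le> 1" for g
    by (rule N1.integrable_const_bound[of _ 1])
      (use I1 that(2) in \<open>auto simp: indicator_def abs_mult intro!: mult_le_one\<close>)
  have J2: "integrable N2 (\<lambda>x. I2 x * indicator A (V x) * g x)"
    if [measurable]: "g \<in> borel_measurable N2" and "\<And>x. \<bar>g x\<bar> \<le> 1" for g
    by (rule N2.integrable_const_bound[of _ 1])
      (use I2 that(2) in \<open>auto simp: indicator_def abs_mult intro!: mult_le_one\<close>)
  have split1: "(\<integral>x. I1 x * indicator A (U x) * g x \<partial>N1) =
      (\<integral>x. (I1 x * (1 + g x)) * indicator A (U x) \<partial>N1) - (\<integral>x. I1 x * indicator A (U x) \<partial>N1)"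
    if [measurable]: "g \<in> borel_measurable N1" and g: "\<And>x. \<bar>g x\<bar> \<le> 1" for g
    using Bochner_Integration.integral_add[OF J1[of "\<lambda>x. 1"] J1[of g]] g
    by (simp add: algebra_simps)
  have split2: "(\<integral>x. I2 x * indicator A (V x) * g x \<partial>N2) =
      (\<integral>x. (I2 x * (1 + g x)) * indicator A (V x) \<partial>N2) - (\<integral>x. I2 x * indicator A (V x) \<partial>N2)"
    if [measurable]: "g \<in> borel_measurable N2" and g: "\<And>x. \<bar>g x\<bar> \<le> 1" for g
    using Bochner_Integration.integral_add[OF J2[of "\<lambda>x. 1"] J2[of g]] g
    by (simp add: algebra_simps)
  \<comment> \<open>The cosine and sine integrals are the real and imaginary parts of the
    claim.\<close>
  have "(\<integral>x. I1 x * indicator A (U x) * cos (W x) \<partial>N1) = (\<integral>x. I2 x * indicator A (V x) * cos (T x) \<partial>N2)"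
    using split1[of "\<lambda>x. cos (W x)"] split2[of "\<lambda>x. cos (T x)"] bc b0 by simp
  moreover have "(\<integral>x. I1 x * indicator A (U x) * sin (W x) \<partial>N1) = (\<integral>x. I2 x * indicator A (V x) * sin (T x) \<partial>N2)"
    using split1[of "\<lambda>x. sin (W x)"] split2[of "\<lambda>x. sin (T x)"] bs b0 by simp
  moreover have K1: "integrable N1 (\<lambda>x. (I1 x * indicator A (U x)) *\<^sub>R iexp (W x))"
    by (rule N1.integrable_const_bound[of _ 1]) (use I1 in \<open>auto simp: indicator_def\<close>)
  moreover have K2: "integrable N2 (\<lambda>x. (I2 x * indicator A (V x)) *\<^sub>R iexp (T x))"
    by (rule N2.integrable_const_bound[of _ 1]) (use I2 in \<open>auto simp: indicator_def\<close>)
  ultimately show ?thesis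
    by (simp add: complex_eq_iff Re_exp Im_exp flip: integral_Re integral_Im)
qed

text \<open>This is the multivariate uniqueness theorem, restricted to boxes. The two measures may
  live on different spaces, so that a space can be compared with its own square.\<close>

lemma char_determines_boxes:
  fixes U :: "nat \<Rightarrow> 'a \<Rightarrow> real" and V :: "nat \<Rightarrow> 'b \<Rightarrow> real"
  assumes N: "finite_measure N1" "finite_measure N2"
    and U [measurable]: "\<And>i. i < k \<Longrightarrow> U i \<in> borel_measurable N1"
    and V [measurable]: "\<And>i. i < k \<Longrightarrow> V i \<in> borel_measurable N2"
    and eq: "\<And>t. (\<integral>x. iexp (\<Sum>i<k. t i * U i x) \<partial>N1) = (\<integral>y. iexp (\<Sum>i<k. t i * V i y) \<partial>N2)"
    and A [measurable]: "\<And>i. A i \<in> sets borel"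
  shows "measure N1 {x \<in> space N1. \<forall>i<k. U i x \<in> A i} = measure N2 {y \<in> space N2. \<forall>i<k. V i y \<in> A i}"
proof -
  define I where "I j x = (\<Prod>i<j. indicator (A i) (U i x) :: real)" for j x
  define J where "J j x = (\<Prod>i<j. indicator (A i) (V i x) :: real)" for j x
  have Im [measurable]: "I j \<in> borel_measurable N1" if "j \<le> k" for j
  proof -
    have [measurable]: "(\<lambda>x. indicator (A i) (U i x) :: real) \<in> borel_measurable N1" if "i < j" for i
    proof -
      have [measurable]: "U i \<in> borel_measurable N1" using that \<open>j \<le> k\<close> by (intro U) simp
      show ?thesis by measurable
    qed
    show ?thesis unfolding I_def by (rule borel_measurable_prod) auto
  qed
  have Jm [measurable]: "J j \<in> borel_measurable N2" if "j \<le> k" for j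
  proof -
    have [measurable]: "(\<lambda>x. indicator (A i) (V i x) :: real) \<in> borel_measurable N2" if "i < j" for i
    proof -
      have [measurable]: "V i \<in> borel_measurable N2" using that \<open>j \<le> k\<close> by (intro V) simp
      show ?thesis by measurable
    qed
    show ?thesis unfolding J_def by (rule borel_measurable_prod) auto
  qed
  have I01: "0 \<le> I j x \<and> I j x \<le> 1" for j x
    unfolding I_def by (auto intro!: prod_nonneg prod_le_1 simp: indicator_def)
  have J01: "0 \<le> J j x \<and> J j x \<le> 1" for j x
    unfolding J_def by (auto intro!: prod_nonneg prod_le_1 simp: indicator_def)
  \<comment> \<open>The invariant is mixed: coordinates below j already appear as indicators, those
    from j on still as frequencies. At j = 0 it is the hypothesis, at j = k the claim.\<close>
  have main: "(\<integral>x. I j x *\<^sub>R iexp (\<Sum>i=j..<k. t i * U i x) \<partial>N1) =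
      (\<integral>x. J j x *\<^sub>R iexp (\<Sum>i=j..<k. t i * V i x) \<partial>N2)" if "j \<le> k" for j t
    using that
  proof (induction j arbitrary: t)
    case 0
    then show ?case using eq[of t] by (simp add: I_def J_def atLeast0LessThan)
  next
    case (Suc j)
    then have jk: "j < k" "j \<le> k" "Suc j \<le> k" by auto
    define W where "W x = (\<Sum>i=Suc j..<k. t i * U i x)" for x
    define T where "T x = (\<Sum>i=Suc j..<k. t i * V i x)" for x
    have [measurable]: "W \<in> borel_measurable N1"
      unfolding W_def by (intro borel_measurable_sum borel_measurable_times) auto
    have [measurable]: "T \<in> borel_measurable N2"
      unfolding T_def by (intro borel_measurable_sum borel_measurable_times) auto
    have "(\<integral>x. (I j x * indicator (A j) (U j x)) *\<^sub>R iexp (W x) \<partial>N1) =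
      (\<integral>x. (J j x * indicator (A j) (V j x)) *\<^sub>R iexp (T x) \<partial>N2)"
    proof (rule char_determines_boxes_step[OF N])
      fix r s :: real
      \<comment> \<open>Coordinate j receives the free frequency r, while s switches the remaining
        phase on, off or to its negative, as \<open>char_determines_boxes_step\<close>
        demands.\<close>
      define t' where "t' i = (if i = j then r else s * t i)" for i
      have "(\<Sum>i=j..<k. t' i * U i x) = r * U j x + s * W x" for x
      proof -
        have "(\<Sum>i=j..<k. t' i * U i x) = r * U j x + (\<Sum>i=Suc j..<k. t' i * U i x)"
          using jk by (subst sum.atLeast_Suc_lessThan) (auto simp: t'_def)
        also have "(\<Sum>i=Suc j..<k. t' i * U i x) = s * W x"
          unfolding W_def sum_distrib_left by (rule sum.cong) (auto simp: t'_def)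
        finally show ?thesis .
      qed
      moreover have "(\<Sum>i=j..<k. t' i * V i x) = r * V j x + s * T x" for x
      proof -
        have "(\<Sum>i=j..<k. t' i * V i x) = r * V j x + (\<Sum>i=Suc j..<k. t' i * V i x)"
          using jk by (subst sum.atLeast_Suc_lessThan) (auto simp: t'_def)
        also have "(\<Sum>i=Suc j..<k. t' i * V i x) = s * T x"
          unfolding T_def sum_distrib_left by (rule sum.cong) (auto simp: t'_def)
        finally show ?thesis .
      qed
      ultimately show "(\<integral>x. I j x *\<^sub>R iexp (r * U j x + s * W x) \<partial>N1) =
        (\<integral>x. J j x *\<^sub>R iexp (r * V j x + s * T x) \<partial>N2)"
        using Suc.IH[of t'] jk by simp
    qed (use jk I01 J01 U V Im Jm in auto)
    then show ?case by (simp add: I_def J_def W_def T_def mult.commute)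
  qed
  have Ik: "I k x = indicator {x. \<forall>i<k. U i x \<in> A i} x" for x
    unfolding I_def by (auto simp: indicator_def)
  have Jk: "J k x = indicator {x. \<forall>i<k. V i x \<in> A i} x" for x
    unfolding J_def by (auto simp: indicator_def)
  have "complex_of_real (\<integral>x. I k x \<partial>N1) = complex_of_real (\<integral>x. J k x \<partial>N2)"
    using main[of k] by (simp add: scaleR_conv_of_real)
  moreover have "(\<integral>x. I k x \<partial>N1) = measure N1 {x \<in> space N1. \<forall>i<k. U i x \<in> A i}"
    unfolding Ik by (simp add: Int_def conj_commute)
  moreover have "(\<integral>x. J k x \<partial>N2) = measure N2 {x \<in> space N2. \<forall>i<k. V i x \<in> A i}"
    unfolding Jk by (simp add: Int_def conj_commute)
  ultimately show ?thesis by simp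
qed

section \<open>Least squares on selected columns\<close>

text \<open>\<open>the\<close> in the definition of \<open>inv_mat\<close> is meaningful only if
  \<open>mat_inverse\<close> succeeds. An invertible matrix is a unit of the matrix ring, which
  excludes \<open>None\<close>.\<close>

lemma inv_mat:
  assumes A: "A \<in> carrier_mat n n" and inv: "invertible_mat A"
  shows "inv_mat A \<in> carrier_mat n n" "A * inv_mat A = 1\<^sub>m n" "inv_mat A * A = 1\<^sub>m n"
proof -
  from inv obtain B where B: "A * B = 1\<^sub>m n" "B * A = 1\<^sub>m (dim_row B)"
    using A unfolding invertible_mat_def inverts_mat_def by auto
  \<comment> \<open>\<open>invertible_mat\<close> does not fix the shape of B; counting columns on
    both sides of the two equations does.\<close>
  have "dim_col (A * B) = dim_col (1\<^sub>m n :: real mat)" "dim_col (B * A) = dim_col (1\<^sub>m (dim_row B) :: real mat)"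
    using B by simp_all
  then have "B \<in> carrier_mat n n" using A by (intro carrier_matI) simp_all
  with B A have "A \<in> Units (ring_mat TYPE(real) n ())"
    by (auto simp: Units_def ring_mat_def)
  then obtain C where "mat_inverse A = Some C"
    using mat_inverse(1)[OF A, of "()"] by (cases "mat_inverse A") auto
  with mat_inverse(2)[OF A this]
  show "inv_mat A \<in> carrier_mat n n" "A * inv_mat A = 1\<^sub>m n" "inv_mat A * A = 1\<^sub>m n"
    by (simp_all add: inv_mat_def)
qed

text \<open>Transposing A * A^-1 = 1 makes the transposed inverse a left inverse of the symmetric A,
  and a left inverse coincides with the two-sided one.\<close>

lemma inv_mat_symmetric:
  assumes A: "A \<in> carrier_mat n n" and inv: "invertible_mat A" and sym: "transpose_mat A = A"
  shows "transpose_mat (inv_mat A) = inv_mat A"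
proof -
  note I = inv_mat[OF A inv]
  have T: "transpose_mat (inv_mat A) \<in> carrier_mat n n" using I(1) by simp
  have "transpose_mat (inv_mat A) * A = transpose_mat (A * inv_mat A)"
    using transpose_mult[OF A I(1)] sym by simp
  then have l: "transpose_mat (inv_mat A) * A = 1\<^sub>m n" by (simp add: I(2))
  have "transpose_mat (inv_mat A) = transpose_mat (inv_mat A) * (A * inv_mat A)"
    using T I(2) by simp
  also have "\<dots> = (transpose_mat (inv_mat A) * A) * inv_mat A"
    using T A I(1) by (simp add: assoc_mult_mat)
  also have "\<dots> = inv_mat A" using l I(1) by simp
  finally show ?thesis .
qed

lemma smult_mat_mult_vec:
  fixes A :: "'a :: comm_semiring_0 mat"
  assumes "A \<in> carrier_mat nr nc" "v \<in> carrier_vec nc"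
  shows "(c \<cdot>\<^sub>m A) *\<^sub>v v = c \<cdot>\<^sub>v (A *\<^sub>v v)"
  using assms by (intro eq_vecI) auto

lemma transpose_smult_mat: "transpose_mat (c \<cdot>\<^sub>m A) = c \<cdot>\<^sub>m transpose_mat A"
  by (intro eq_matI) auto

lemma sq_norm_pos:
  assumes "v \<in> carrier_vec n" "v \<noteq> 0\<^sub>v n"
  shows "0 < sq_norm v"
proof -
  obtain i where i: "i < n" "v $ i \<noteq> 0"
    using assms by (metis carrier_vecD eq_vecI index_zero_vec)
  have "0 < v $ i * v $ i" using i by (metis not_real_square_gt_zero)
  also have "\<dots> \<le> (\<Sum>j = 0..<dim_vec v. v $ j * v $ j)"
    using i assms by (intro member_le_sum) auto
  finally show ?thesis by (simp add: sq_norm_def scalar_prod_def)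
qed

lemma sq_norm_minus:
  assumes [simp]: "u \<in> carrier_vec n" "w \<in> carrier_vec n"
  shows "sq_norm (u - w) = sq_norm u - 2 * (u \<bullet> w) + sq_norm w"
  unfolding sq_norm_def
  by (simp add: minus_scalar_prod_distrib[of _ n] scalar_prod_minus_distrib[of _ n]
      comm_scalar_prod[of w n u])

text \<open>\<open>arg_min_on\<close> is a choice among minimisers; strictness leaves it only one
  candidate.\<close>

lemma arg_min_on_eqI:
  fixes f :: "'a \<Rightarrow> real"
  assumes "x \<in> S" "\<And>y. y \<in> S \<Longrightarrow> y \<noteq> x \<Longrightarrow> f x < f y"
  shows "arg_min_on f S = x"
  unfolding arg_min_on_def arg_min_def is_arg_min_def
proof (rule some_equality)
  show "x \<in> S \<and> \<not> (\<exists>y. y \<in> S \<and> f y < f x)" using assms by (metis less_asym less_irrefl)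
next
  fix z assume "z \<in> S \<and> \<not> (\<exists>y. y \<in> S \<and> f y < f z)"
  then show "z = x" using assms by metis
qed

lemma cols_of_carrier:
  assumes "X \<in> carrier_mat n p" "m \<subseteq> {..<p}"
  shows "cols_of X m \<in> carrier_mat n (card m)"
proof -
  have "{j. j < p \<and> j \<in> m} = m" using assms(2) by auto
  with assms(1) show ?thesis
    unfolding cols_of_def by (intro carrier_matI) (simp_all add: dim_submatrix)
qed

text \<open>For full column rank this is the Moore-Penrose pseudo-inverse of the selected columns.
  With A for this matrix, the estimator is A y and the sandwich is A S A^T.\<close>

definition ls_mat :: "real mat \<Rightarrow> nat set \<Rightarrow> real mat" where
  "ls_mat X m = inv_mat (gram X m) * transpose_mat (cols_of X m)"

lemma ls_solution_eq: "ls_solution X m y = ls_mat X m *\<^sub>v y"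
  by (simp add: ls_solution_def ls_mat_def)

locale full_rank_selection =
  fixes X :: "real mat" and n p :: nat and m :: "nat set"
  assumes X: "X \<in> carrier_mat n p" and m: "m \<subseteq> {..<p}" and inv: "invertible_mat (gram X m)"
begin

lemma cols_carrier: "cols_of X m \<in> carrier_mat n (card m)"
  using cols_of_carrier[OF X m] .

lemma gram_carrier: "gram X m \<in> carrier_mat (card m) (card m)"
  unfolding gram_def using cols_carrier by simp

lemma gram_symmetric: "transpose_mat (gram X m) = gram X m"
  unfolding gram_def using transpose_mult[of "transpose_mat (cols_of X m)" "card m" n "cols_of X m" "card m"] cols_carrier
  by simp

lemmas gram_inverse = inv_mat[OF gram_carrier inv]

lemma ls_mat_carrier: "ls_mat X m \<in> carrier_mat (card m) n"
  unfolding ls_mat_def using gram_inverse(1) cols_carrier by simp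

lemma ls_mat_transpose: "transpose_mat (ls_mat X m) = cols_of X m * inv_mat (gram X m)"
  unfolding ls_mat_def
  using transpose_mult[OF gram_inverse(1), of "transpose_mat (cols_of X m)" n] cols_carrier
    inv_mat_symmetric[OF gram_carrier inv gram_symmetric] by simp

lemma ls_solution_carrier: "y \<in> carrier_vec n \<Longrightarrow> ls_solution X m y \<in> carrier_vec (card m)"
  unfolding ls_solution_eq using ls_mat_carrier by simp

text \<open>The Gram matrix cancels its inverse. Read the other way, the residual is orthogonal to
  all selected columns.\<close>

lemma normal_equations:
  assumes y: "y \<in> carrier_vec n"
  shows "transpose_mat (cols_of X m) *\<^sub>v (cols_of X m *\<^sub>v ls_solution X m y) =
    transpose_mat (cols_of X m) *\<^sub>v y"
proof -
  have T: "transpose_mat (cols_of X m) \<in> carrier_mat (card m) n" using cols_carrier by simp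
  have v: "transpose_mat (cols_of X m) *\<^sub>v y \<in> carrier_vec (card m)" using T y by simp
  have "transpose_mat (cols_of X m) *\<^sub>v (cols_of X m *\<^sub>v ls_solution X m y) =
    gram X m *\<^sub>v ls_solution X m y"
    unfolding gram_def using assoc_mult_mat_vec[OF T cols_carrier ls_solution_carrier[OF y]] by simp
  also have "gram X m *\<^sub>v ls_solution X m y =
      gram X m *\<^sub>v (inv_mat (gram X m) *\<^sub>v (transpose_mat (cols_of X m) *\<^sub>v y))"
    unfolding ls_solution_def using assoc_mult_mat_vec[OF gram_inverse(1) T y] by simp
  also have "\<dots> = (gram X m * inv_mat (gram X m)) *\<^sub>v (transpose_mat (cols_of X m) *\<^sub>v y)"
    using assoc_mult_mat_vec[OF gram_carrier gram_inverse(1) v] by simp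
  also have "\<dots> = transpose_mat (cols_of X m) *\<^sub>v y"
    unfolding gram_inverse(2) using v by simp
  finally show ?thesis .
qed

text \<open>With C for the selected columns, C e = 0 implies C^T C e = 0, and the Gram matrix C^T C
  can be inverted. In this way invertibility delivers full column rank.\<close>

lemma cols_injective:
  assumes e: "e \<in> carrier_vec (card m)" and 0: "cols_of X m *\<^sub>v e = 0\<^sub>v n"
  shows "e = 0\<^sub>v (card m)"
proof -
  have T: "transpose_mat (cols_of X m) \<in> carrier_mat (card m) n" using cols_carrier by simp
  have "gram X m *\<^sub>v e = transpose_mat (cols_of X m) *\<^sub>v (cols_of X m *\<^sub>v e)"
    unfolding gram_def using assoc_mult_mat_vec[OF T cols_carrier e] .
  also have "\<dots> = 0\<^sub>v (card m)" unfolding 0 using T by (intro eq_vecI) (auto simp: mult_mat_vec_def)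
  finally have G0: "gram X m *\<^sub>v e = 0\<^sub>v (card m)" .
  have "e = (inv_mat (gram X m) * gram X m) *\<^sub>v e" unfolding gram_inverse(3) using e by simp
  also have "\<dots> = inv_mat (gram X m) *\<^sub>v 0\<^sub>v (card m)"
    using assoc_mult_mat_vec[OF gram_inverse(1) gram_carrier e] G0 by simp
  also have "\<dots> = 0\<^sub>v (card m)" using gram_inverse(1) by (intro eq_vecI) (auto simp: mult_mat_vec_def)
  finally show ?thesis .
qed

text \<open>Pythagoras: moving from the solution to b changes the residual r by C e, which is
  orthogonal to r and nonzero because C is injective.\<close>

lemma ls_solution_strict_min:
  assumes y: "y \<in> carrier_vec n" and b: "b \<in> carrier_vec (card m)" "b \<noteq> ls_solution X m y"
  shows "sq_norm (y - cols_of X m *\<^sub>v ls_solution X m y) < sq_norm (y - cols_of X m *\<^sub>v b)"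
proof -
  let ?C = "cols_of X m" and ?s = "ls_solution X m y"
  have T: "transpose_mat ?C \<in> carrier_mat (card m) n" using cols_carrier by simp
  have s: "?s \<in> carrier_vec (card m)" using ls_solution_carrier[OF y] .
  define e where "e = b - ?s"
  have e: "e \<in> carrier_vec (card m)" unfolding e_def using b s by simp
  have Cs: "?C *\<^sub>v ?s \<in> carrier_vec n" and Cb: "?C *\<^sub>v b \<in> carrier_vec n" and Ce: "?C *\<^sub>v e \<in> carrier_vec n"
    using cols_carrier s b e by auto
  define r where "r = y - ?C *\<^sub>v ?s"
  have r: "r \<in> carrier_vec n" unfolding r_def using y Cs by simp
  have "e \<noteq> 0\<^sub>v (card m)"
  proof
    assume "e = 0\<^sub>v (card m)"
    then have "(b - ?s) $ i = 0" if "i < card m" for i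
      unfolding e_def using that by simp
    then have "b $ i = ?s $ i" if "i < card m" for i
      using that carrier_vecD[OF s] by simp
    then have "b = ?s" using b s by (intro eq_vecI) auto
    with b show False by simp
  qed
  then have Ce0: "0 < sq_norm (?C *\<^sub>v e)"
    using cols_injective[OF e] sq_norm_pos[OF Ce] by blast
  have "transpose_mat ?C *\<^sub>v r = transpose_mat ?C *\<^sub>v y - transpose_mat ?C *\<^sub>v (?C *\<^sub>v ?s)"
    unfolding r_def using mult_minus_distrib_mat_vec[OF T y Cs] .
  also have "\<dots> = 0\<^sub>v (card m)"
    unfolding normal_equations[OF y] using T y by (intro minus_cancel_vec) simp
  finally have "r \<bullet> (?C *\<^sub>v e) = 0"
    using transpose_vec_mult_scalar[OF cols_carrier e r] e by simp
  moreover have "y - ?C *\<^sub>v b = r - ?C *\<^sub>v e"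
    unfolding r_def e_def mult_minus_distrib_mat_vec[OF cols_carrier b(1) s] using y Cs Cb
    by (intro eq_vecI) auto
  ultimately have "sq_norm (y - ?C *\<^sub>v b) = sq_norm r + sq_norm (?C *\<^sub>v e)"
    using sq_norm_minus[OF r Ce] by simp
  with Ce0 show ?thesis by (simp add: r_def)
qed

lemma beta_hat_eq:
  assumes "y \<in> carrier_vec n"
  shows "beta_hat X m y = ls_solution X m y"
  unfolding beta_hat_def
  by (intro arg_min_on_eqI ls_solution_carrier[OF assms] ls_solution_strict_min[OF assms])

end

section \<open>Covariance matrix of the least squares estimator\<close>

locale fission_covariance = full_rank_selection +
  fixes S :: "real mat" and \<tau> :: real
  assumes S: "covariance_mat n S"
begin

lemma S_carrier: "S \<in> carrier_mat n n"
  using S by (simp add: covariance_mat_def)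

lemma fission_var_eq:
  "fission_var X m S \<tau> = (1 + 1 / \<tau>\<^sup>2) \<cdot>\<^sub>m (ls_mat X m * S * transpose_mat (ls_mat X m))"
proof -
  have "ls_mat X m * S \<in> carrier_mat (card m) n" using ls_mat_carrier S_carrier by simp
  then have "ls_mat X m * S * cols_of X m * inv_mat (gram X m) =
      ls_mat X m * S * (cols_of X m * inv_mat (gram X m))"
    using cols_carrier gram_inverse(1) by (rule assoc_mult_mat)
  then show ?thesis
    unfolding fission_var_def sandwich_def ls_mat_transpose by (simp add: ls_mat_def)
qed

lemma fission_var_carrier: "fission_var X m S \<tau> \<in> carrier_mat (card m) (card m)"
  unfolding fission_var_eq using ls_mat_carrier S_carrier by simp

text \<open>The factor A of A S A^T moves across the scalar product, so a quadratic form in the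
  coefficients becomes one of S at A^T a. Nonnegativity, positive variances and the law of the
  estimator all rest on this.\<close>

lemma fission_var_form:
  assumes a: "a \<in> carrier_vec (card m)"
  shows "a \<bullet> (fission_var X m S \<tau> *\<^sub>v a) = (1 + 1 / \<tau>\<^sup>2) *
    ((transpose_mat (ls_mat X m) *\<^sub>v a) \<bullet> (S *\<^sub>v (transpose_mat (ls_mat X m) *\<^sub>v a)))"
proof -
  let ?A = "ls_mat X m" and ?T = "transpose_mat (ls_mat X m)"
  have T: "?T \<in> carrier_mat n (card m)" using ls_mat_carrier by simp
  have Ta: "?T *\<^sub>v a \<in> carrier_vec n" using T a by simp
  have AS: "?A * S \<in> carrier_mat (card m) n" using ls_mat_carrier S_carrier by simp
  have "fission_var X m S \<tau> *\<^sub>v a = (1 + 1 / \<tau>\<^sup>2) \<cdot>\<^sub>v ((?A * S * ?T) *\<^sub>v a)"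
    unfolding fission_var_eq by (rule smult_mat_mult_vec[OF mult_carrier_mat[OF AS T] a])
  also have "(?A * S * ?T) *\<^sub>v a = ?A *\<^sub>v (S *\<^sub>v (?T *\<^sub>v a))"
    using assoc_mult_mat_vec[OF AS T a] assoc_mult_mat_vec[OF ls_mat_carrier S_carrier Ta] by simp
  finally have "a \<bullet> (fission_var X m S \<tau> *\<^sub>v a) = (1 + 1 / \<tau>\<^sup>2) * (a \<bullet> (?A *\<^sub>v (S *\<^sub>v (?T *\<^sub>v a))))"
    using a ls_mat_carrier by simp
  also have "a \<bullet> (?A *\<^sub>v (S *\<^sub>v (?T *\<^sub>v a))) = (?T *\<^sub>v a) \<bullet> (S *\<^sub>v (?T *\<^sub>v a))"
    using transpose_vec_mult_scalar[OF ls_mat_carrier mult_mat_vec_carrier[OF S_carrier Ta] a] by simp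
  finally show ?thesis .
qed

lemma fission_var_covariance: "covariance_mat (card m) (fission_var X m S \<tau>)"
  unfolding covariance_mat_def
proof (intro conjI ballI)
  let ?A = "ls_mat X m"
  have A: "?A \<in> carrier_mat (card m) n" using ls_mat_carrier .
  have "transpose_mat (?A * S * transpose_mat ?A) = ?A * (S * transpose_mat ?A)"
    using transpose_mult[of "?A * S" "card m" n "transpose_mat ?A" "card m"]
      transpose_mult[OF A S_carrier] A S_carrier S by (simp add: covariance_mat_def)
  then show "transpose_mat (fission_var X m S \<tau>) = fission_var X m S \<tau>"
    unfolding fission_var_eq using A S_carrier
    by (simp add: transpose_smult_mat assoc_mult_mat[OF A S_carrier, of "transpose_mat ?A" "card m"])
  fix v :: "real vec" assume v: "v \<in> carrier_vec (card m)"
  have "transpose_mat ?A *\<^sub>v v \<in> carrier_vec n" using A v by simp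
  then show "0 \<le> v \<bullet> (fission_var X m S \<tau> *\<^sub>v v)"
    unfolding fission_var_form[OF v] using S unfolding covariance_mat_def
    by (intro mult_nonneg_nonneg) auto
qed (rule fission_var_carrier)

lemma fission_var_diag:
  assumes k: "k < card m"
  shows "unit_vec (card m) k \<bullet> (fission_var X m S \<tau> *\<^sub>v unit_vec (card m) k) = fission_var X m S \<tau> $$ (k, k)"
  using fission_var_carrier k by simp

text \<open>The entry is a positive multiple of the form of S at A^T e_k = C (C^T C)^-1 e_k. This
  vector is nonzero, since C is injective and the inverse Gram matrix is invertible.\<close>

lemma fission_var_diag_pos:
  assumes pd: "pos_def_mat n S" and k: "k < card m"
  shows "0 < fission_var X m S \<tau> $$ (k, k)"
proof -
  let ?u = "unit_vec (card m) k :: real vec"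
  have u: "?u \<in> carrier_vec (card m)" by simp
  have "transpose_mat (ls_mat X m) *\<^sub>v ?u \<noteq> 0\<^sub>v n"
  proof
    assume "transpose_mat (ls_mat X m) *\<^sub>v ?u = 0\<^sub>v n"
    then have "cols_of X m *\<^sub>v (inv_mat (gram X m) *\<^sub>v ?u) = 0\<^sub>v n"
      unfolding ls_mat_transpose using assoc_mult_mat_vec[OF cols_carrier gram_inverse(1) u] by simp
    then have "inv_mat (gram X m) *\<^sub>v ?u = 0\<^sub>v (card m)"
      using gram_inverse(1) by (intro cols_injective) auto
    moreover have "?u = gram X m *\<^sub>v (inv_mat (gram X m) *\<^sub>v ?u)"
      using assoc_mult_mat_vec[OF gram_carrier gram_inverse(1) u] gram_inverse(2) by simp
    ultimately have "?u = gram X m *\<^sub>v 0\<^sub>v (card m)" by simp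
    also have "\<dots> = 0\<^sub>v (card m)" using gram_carrier by (intro eq_vecI) (auto simp: mult_mat_vec_def)
    finally have "?u $ k = 0\<^sub>v (card m) $ k" by simp
    with k show False by simp
  qed
  moreover have "transpose_mat (ls_mat X m) *\<^sub>v ?u \<in> carrier_vec n" using ls_mat_carrier by simp
  ultimately have "0 < (transpose_mat (ls_mat X m) *\<^sub>v ?u) \<bullet> (S *\<^sub>v (transpose_mat (ls_mat X m) *\<^sub>v ?u))"
    using pd unfolding pos_def_mat_def by blast
  moreover have "0 < 1 + 1 / \<tau>\<^sup>2" by (simp add: add_pos_nonneg)
  ultimately show ?thesis
    unfolding fission_var_diag[OF k, symmetric] fission_var_form[OF u] by simp
qed

end

section \<open>Univariate normal laws\<close>

text \<open>One formula covers both the point mass and the density, so that later facts on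
  \<open>normal_law\<close> reduce to the standard normal law.\<close>

lemma normal_law_affine:
  assumes "0 \<le> v"
  shows "normal_law m v = distr std_normal_distribution borel (\<lambda>x. m + sqrt v * x)"
proof (cases "v = 0")
  case True
  interpret prob_space std_normal_distribution by (rule prob_space_normal_density) simp
  show ?thesis using True by (simp add: normal_law_def distr_const)
next
  case False
  interpret prob_space std_normal_distribution by (rule prob_space_normal_density) simp
  have "distributed std_normal_distribution lborel (\<lambda>x. x) std_normal_density"
    by (auto simp: distributed_def distr_id2)
  from normal_density_affine[OF this, of "sqrt v" m] False assms
  have "distributed std_normal_distribution lborel (\<lambda>x. m + sqrt v * x) (normal_density m (sqrt v))"
    by simp
  then have "distr std_normal_distribution lborel (\<lambda>x. m + sqrt v * x) = density lborel (normal_density m (sqrt v))"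
    by (simp add: distributed_def)
  moreover have "distr std_normal_distribution lborel (\<lambda>x. m + sqrt v * x) = distr std_normal_distribution borel (\<lambda>x. m + sqrt v * x)"
    by (rule distr_cong) auto
  ultimately show ?thesis using False by (simp add: normal_law_def)
qed

lemma real_distribution_normal_law:
  assumes "0 \<le> v"
  shows "real_distribution (normal_law m v)"
proof -
  interpret prob_space std_normal_distribution by (rule prob_space_normal_density) simp
  show ?thesis unfolding normal_law_affine[OF assms] by (rule real_distribution_distr) simp
qed

lemma char_normal_law:
  assumes "0 \<le> v"
  shows "char (normal_law m v) t = iexp (t * m) * exp (- (v * t\<^sup>2) / 2)"
proof -
  interpret prob_space std_normal_distribution by (rule prob_space_normal_density) simp
  have "char (normal_law m v) t = (\<integral>x. iexp (t * (m + sqrt v * x)) \<partial>std_normal_distribution)"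
    unfolding normal_law_affine[OF assms] char_def by (subst integral_distr) auto
  also have "\<dots> = (\<integral>x. iexp (t * m) * iexp ((t * sqrt v) * x) \<partial>std_normal_distribution)"
    by (simp add: exp_add[symmetric] algebra_simps)
  also have "\<dots> = iexp (t * m) * char std_normal_distribution (t * sqrt v)"
    unfolding char_def by (rule integral_mult_right_zero)
  also have "char std_normal_distribution (t * sqrt v) = exp (- (v * t\<^sup>2) / 2)"
    using assms by (simp add: char_std_normal_distribution power_mult_distrib mult.commute)
  finally show ?thesis .
qed

text \<open>These moments serve the expected squared loss in \<open>beta_star\<close>.\<close>

lemma normal_law_second_moment:
  assumes "0 \<le> v"
  shows "integrable (normal_law m v) (\<lambda>x. x)" "integral\<^sup>L (normal_law m v) (\<lambda>x. x) = m"
    "integrable (normal_law m v) (\<lambda>x. x\<^sup>2)"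
proof -
  interpret prob_space std_normal_distribution by (rule prob_space_normal_density) simp
  have i1: "integrable std_normal_distribution (\<lambda>x. x)" and i2: "integrable std_normal_distribution (\<lambda>x. x\<^sup>2)"
    using integrable_std_normal_distribution_moment[of 1] integrable_std_normal_distribution_moment[of 2]
    by simp_all
  have e1: "(\<integral>x. x \<partial>std_normal_distribution) = 0"
    using integral_std_normal_distribution_moment_odd[of 1] by simp
  have lin: "integrable std_normal_distribution (\<lambda>x. m + sqrt v * x)"
    using i1 by (intro Bochner_Integration.integrable_add integrable_mult_right integrable_const)
  have aff: "(\<lambda>x. m + sqrt v * x) \<in> borel_measurable std_normal_distribution" by simp
  show "integrable (normal_law m v) (\<lambda>x. x)"
    unfolding normal_law_affine[OF assms]
    by (rule iffD2[OF integrable_distr_eq[OF aff]], simp, rule lin)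
  have "(\<integral>x. m + sqrt v * x \<partial>std_normal_distribution) = m + sqrt v * (\<integral>x. x \<partial>std_normal_distribution)"
    using i1 prob_space by (simp add: Bochner_Integration.integral_add)
  then show "integral\<^sup>L (normal_law m v) (\<lambda>x. x) = m"
    unfolding normal_law_affine[OF assms] using e1 by (subst integral_distr[OF aff]) simp_all
  have "integrable std_normal_distribution (\<lambda>x. m\<^sup>2 + 2 * m * sqrt v * x + (sqrt v)\<^sup>2 * x\<^sup>2)"
    using i1 i2 by (intro Bochner_Integration.integrable_add integrable_mult_right) auto
  also have "(\<lambda>x. m\<^sup>2 + 2 * m * sqrt v * x + (sqrt v)\<^sup>2 * x\<^sup>2) = (\<lambda>x. (m + sqrt v * x)\<^sup>2)"
    by (simp only: power2_sum power_mult_distrib) (simp add: fun_eq_iff)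
  finally have sq: "integrable std_normal_distribution (\<lambda>x. (m + sqrt v * x)\<^sup>2)" .
  show "integrable (normal_law m v) (\<lambda>x. x\<^sup>2)"
    unfolding normal_law_affine[OF assms]
    by (rule iffD2[OF integrable_distr_eq[OF aff]], simp, rule sq)
qed

text \<open>The standard normal law is its own image under the affine map with scale -1 and shift 0,
  and negation exchanges the two tails.\<close>

lemma std_normal_symmetric:
  "measure std_normal_distribution {..< -z} = measure std_normal_distribution {z<..}"
proof -
  interpret prob_space std_normal_distribution by (rule prob_space_normal_density) simp
  have "distributed std_normal_distribution lborel (\<lambda>x. x) std_normal_density"
    by (auto simp: distributed_def distr_id2)
  from normal_density_affine[OF this, of "-1" 0]
  have "distr std_normal_distribution lborel uminus = std_normal_distribution"
    by (simp add: distributed_def)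
  then have "measure std_normal_distribution {..< -z} = measure (distr std_normal_distribution lborel uminus) {..< -z}"
    by simp
  also have "\<dots> = measure std_normal_distribution (uminus -` {..< -z} \<inter> space std_normal_distribution)"
    by (rule measure_distr) auto
  also have "uminus -` {..< -z} \<inter> space std_normal_distribution = {z<..}" by auto
  finally show ?thesis .
qed

text \<open>The density vanishes nowhere, so a null set of the normal law is Lebesgue null, which an
  interval of positive length is not. This gives uniqueness of quantiles.\<close>

lemma std_normal_interval_pos:
  assumes "a < b"
  shows "0 < measure std_normal_distribution {a<..b}"
proof (rule ccontr)
  interpret prob_space std_normal_distribution by (rule prob_space_normal_density) simp
  assume "\<not> 0 < measure std_normal_distribution {a<..b}"
  then have "measure std_normal_distribution {a<..b} = 0" using measure_nonneg[of std_normal_distribution "{a<..b}"] by linarith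
  then have "{a<..b} \<in> null_sets std_normal_distribution" by (simp add: null_sets_def emeasure_eq_measure)
  then have "AE x in lborel. x \<in> {a<..b} \<longrightarrow> ennreal (std_normal_density x) = 0"
    by (subst (asm) null_sets_density_iff) auto
  moreover have "ennreal (std_normal_density x) \<noteq> 0" for x
    using normal_density_pos[of 1 0 x] by simp
  ultimately have "AE x in lborel. x \<notin> {a<..b}" by auto
  then have "emeasure lborel {a<..b} = 0"
    by (subst (asm) AE_iff_measurable[of "{a<..b}"]) auto
  with assms show False by simp
qed

lemma upper_tail_eq: "measure std_normal_distribution {z<..} = 1 - cdf std_normal_distribution z"
proof -
  interpret prob_space std_normal_distribution by (rule prob_space_normal_density) simp
  have "measure std_normal_distribution {z<..} = measure std_normal_distribution (space std_normal_distribution - {..z})"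
    by (rule arg_cong[where f = "measure std_normal_distribution"]) auto
  also have "\<dots> = 1 - cdf std_normal_distribution z"
    unfolding cdf_def by (rule prob_compl) simp
  finally show ?thesis .
qed

text \<open>The quantile is a definite description. Existence comes from the intermediate value
  theorem for the distribution function, uniqueness from the positive mass between two
  candidates.\<close>

lemma normal_upper_quantile_tail:
  assumes q: "0 < q" "q < 1"
  shows "measure std_normal_distribution {normal_upper_quantile q<..} = q"
proof -
  interpret real_distribution std_normal_distribution by (rule real_dist_normal_dist)
  \<comment> \<open>A distribution function is continuous exactly where there is no atom.\<close>
  have cont: "isCont (cdf std_normal_distribution) z" for z
  proof -
    have "{z} \<in> null_sets std_normal_distribution"
      by (subst null_sets_density_iff, simp, intro conjI)
        (simp, rule eventually_mono[OF AE_lborel_singleton[of z]], simp)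
    then show ?thesis unfolding isCont_cdf by (simp add: null_sets_def measure_def)
  qed
  have "\<forall>\<^sub>F x in at_top. cdf std_normal_distribution x > 1 - q"
    using cdf_lim_at_top_prob q by (intro order_tendstoD(1)) auto
  then obtain b where b: "cdf std_normal_distribution b > 1 - q" by (auto dest: eventually_happens)
  have "\<forall>\<^sub>F x in at_bot. cdf std_normal_distribution x < 1 - q"
    using cdf_lim_at_bot q by (intro order_tendstoD(2)) auto
  then obtain a where a: "cdf std_normal_distribution a < 1 - q" by (auto dest: eventually_happens)
  have "a \<le> b"
  proof (rule ccontr)
    assume "\<not> a \<le> b"
    then show False using a b cdf_nondecreasing[of b a] by linarith
  qed
  have "\<exists>z\<ge>a. z \<le> b \<and> cdf std_normal_distribution z = 1 - q"
    by (rule IVT) (use a b cont \<open>a \<le> b\<close> in simp_all)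
  then obtain z where z: "cdf std_normal_distribution z = 1 - q" by blast
  have mono: "measure std_normal_distribution {y<..} < measure std_normal_distribution {x<..}" if "x < y" for x y :: real
  proof -
    have "{x<..} = {x<..y} \<union> {y<..}" using that by auto
    then have "measure std_normal_distribution {x<..} = measure std_normal_distribution {x<..y} + measure std_normal_distribution {y<..}"
      by (simp add: finite_measure_Union[symmetric] Int_def disjoint_iff)
    with std_normal_interval_pos[OF that] show ?thesis by simp
  qed
  show ?thesis
    unfolding normal_upper_quantile_def
  proof (rule theI)
    show "measure std_normal_distribution {z<..} = q" using z by (simp add: upper_tail_eq)
    fix y assume "measure std_normal_distribution {y<..} = q"
    then show "y = z"
      using mono[of y z] mono[of z y] z by (cases y z rule: linorder_cases) (auto simp: upper_tail_eq)
  qed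
qed

text \<open>Two tails of mass \<alpha>/2 each are removed. For v = 0 the interval is the single
  point m, which carries the whole mass.\<close>

lemma normal_law_central_interval:
  fixes \<alpha> v m :: real
  assumes \<alpha>: "0 < \<alpha>" "\<alpha> < 1" and v: "0 \<le> v"
  defines "h \<equiv> normal_upper_quantile (\<alpha> / 2) * sqrt v"
  shows "measure (normal_law m v) {m - h..m + h} = (if v = 0 then 1 else 1 - \<alpha>)"
proof -
  interpret real_distribution std_normal_distribution by (rule real_dist_normal_dist)
  define z where "z = normal_upper_quantile (\<alpha> / 2)"
  have tail: "measure std_normal_distribution {z<..} = \<alpha> / 2"
    unfolding z_def using \<alpha> by (intro normal_upper_quantile_tail) auto
  have tail': "measure std_normal_distribution {..< -z} = \<alpha> / 2"
    using std_normal_symmetric[of z] tail by simp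
  \<comment> \<open>For negative z the two tails would cover the line, although their masses add up
    to \<alpha> < 1. Nonnegativity makes the tails disjoint below.\<close>
  have "0 \<le> z"
  proof (rule ccontr)
    assume "\<not> 0 \<le> z"
    then have "space std_normal_distribution \<subseteq> {..< -z} \<union> {z<..}" by auto
    then have "measure std_normal_distribution (space std_normal_distribution) \<le> measure std_normal_distribution ({..< -z} \<union> {z<..})"
      by (intro finite_measure_mono) auto
    also have "\<dots> \<le> measure std_normal_distribution {..< -z} + measure std_normal_distribution {z<..}"
      by (rule measure_Un_le) auto
    finally show False using tail tail' \<alpha> prob_space by simp
  qed
  have central: "measure std_normal_distribution {-z..z} = 1 - \<alpha>"
  proof -
    have "{-z..z} = space std_normal_distribution - ({..< -z} \<union> {z<..})" by auto
    then have "measure std_normal_distribution {-z..z} = 1 - measure std_normal_distribution ({..< -z} \<union> {z<..})"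
      by (simp only: prob_compl sets.Un sets_density) (subst prob_compl, auto)
    also have "measure std_normal_distribution ({..< -z} \<union> {z<..}) = \<alpha>"
      using \<open>0 \<le> z\<close> tail tail' by (subst finite_measure_Union) auto
    finally show ?thesis .
  qed
  have "measure (normal_law m v) {m - h..m + h} =
      measure std_normal_distribution ((\<lambda>x. m + sqrt v * x) -` {m - h..m + h} \<inter> space std_normal_distribution)"
    unfolding normal_law_affine[OF v] by (rule measure_distr) auto
  also have "(\<lambda>x. m + sqrt v * x) -` {m - h..m + h} \<inter> space std_normal_distribution = (if v = 0 then UNIV else {-z..z})"
  proof (cases "v = 0")
    case False
    then have s: "0 < sqrt v" using v by simp
    have "(m - h \<le> m + sqrt v * x \<and> m + sqrt v * x \<le> m + h) \<longleftrightarrow> -z \<le> x \<and> x \<le> z" for x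
    proof -
      have "(m - h \<le> m + sqrt v * x) \<longleftrightarrow> sqrt v * (-z) \<le> sqrt v * x"
        unfolding h_def z_def[symmetric] by (simp add: mult.commute)
      moreover have "(m + sqrt v * x \<le> m + h) \<longleftrightarrow> sqrt v * x \<le> sqrt v * z"
        unfolding h_def z_def[symmetric] by (simp add: mult.commute)
      ultimately show ?thesis using s by (simp only: mult_le_cancel_left_pos)
    qed
    then show ?thesis using False by auto
  qed (simp add: h_def)
  also have "measure std_normal_distribution \<dots> = (if v = 0 then 1 else 1 - \<alpha>)"
    using central prob_space by simp
  finally show ?thesis .
qed

section \<open>Independence and conditioning\<close>

lemma iexp_integrable:
  assumes "finite_measure N" and [measurable]: "f \<in> borel_measurable N"
  shows "complex_integrable N (\<lambda>x. iexp (f x))"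
  using assms(1) by (rule finite_measure.integrable_const_bound[where B = 1]) auto

text \<open>By Fubini the characteristic function factors on the product space, which makes that
  space the reference model of independence.\<close>

lemma (in prob_space) iexp_integral_pair:
  assumes [measurable]: "f \<in> borel_measurable M" "g \<in> borel_measurable M"
  shows "(\<integral>y. iexp (f (fst y) + g (snd y)) \<partial>(M \<Otimes>\<^sub>M M)) = (\<integral>x. iexp (f x) \<partial>M) * (\<integral>x. iexp (g x) \<partial>M)"
proof -
  interpret PP: pair_prob_space M M ..
  have i: "complex_integrable (M \<Otimes>\<^sub>M M) (\<lambda>y. iexp (f (fst y) + g (snd y)))"
    by (rule iexp_integrable[OF PP.finite_measure_axioms]) measurable
  have "(\<integral>y. iexp (f (fst y) + g (snd y)) \<partial>(M \<Otimes>\<^sub>M M)) = (\<integral>x. \<integral>z. iexp (f x + g z) \<partial>M \<partial>M)"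
    using PP.integral_fst'[OF i] by simp
  also have "\<dots> = (\<integral>x. iexp (f x) * (\<integral>z. iexp (g z) \<partial>M) \<partial>M)"
    by (simp add: distrib_left exp_add)
  also have "\<dots> = (\<integral>x. iexp (f x) \<partial>M) * (\<integral>x. iexp (g x) \<partial>M)"
    by (rule integral_mult_left_zero)
  finally show ?thesis .
qed

text \<open>The vectors v and w are concatenated into one family of n + k coordinates; indices from
  n on address w, shifted by n.\<close>

lemma sum_split_coordinates:
  fixes v w :: "real vec"
  assumes v: "v \<in> carrier_vec n" and w: "w \<in> carrier_vec k"
  shows "(\<Sum>i<n + k. t i * (if i < n then v $ i else w $ (i - n))) =
    vec n t \<bullet> v + vec k (\<lambda>i. t (n + i)) \<bullet> w"
proof -
  have "(\<Sum>i<n + k. t i * (if i < n then v $ i else w $ (i - n))) =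
    (\<Sum>i=0..<n. t i * v $ i) + (\<Sum>i=n..<n+k. t i * w $ (i - n))"
    unfolding lessThan_atLeast0 by (subst sum.atLeastLessThan_concat[of 0 n "n + k", symmetric]) auto
  also have "(\<Sum>i=n..<n+k. t i * w $ (i - n)) = (\<Sum>i=0..<k. t (n + i) * w $ i)"
    by (subst sum.atLeastLessThan_shift_0) (simp add: atLeast0LessThan)
  also have "(\<Sum>i=0..<n. t i * v $ i) + \<dots> = vec n t \<bullet> v + vec k (\<lambda>i. t (n + i)) \<bullet> w"
    using v w by (simp add: scalar_prod_def)
  finally show ?thesis .
qed

text \<open>The pair (f, g) on \<open>M\<close> and the pair of f in the first and g in the second
  coordinate of the product space have the same characteristic function by \<open>fac\<close>. Hence
  they give boxes the same probability, and on the product space a box is a rectangle.\<close>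

lemma (in prob_space) char_factor_imp_indep_orthants:
  assumes f: "random_vec M n f" and g: "random_vec M k g"
    and fac: "\<And>a b. a \<in> carrier_vec n \<Longrightarrow> b \<in> carrier_vec k \<Longrightarrow>
      (\<integral>\<omega>. iexp (a \<bullet> f \<omega> + b \<bullet> g \<omega>) \<partial>M) = (\<integral>\<omega>. iexp (a \<bullet> f \<omega>) \<partial>M) * (\<integral>\<omega>. iexp (b \<bullet> g \<omega>) \<partial>M)"
  shows "prob ({\<omega> \<in> space M. \<forall>i<n. f \<omega> $ i \<le> c i} \<inter> {\<omega> \<in> space M. \<forall>i<k. g \<omega> $ i \<le> d i}) =
    prob {\<omega> \<in> space M. \<forall>i<n. f \<omega> $ i \<le> c i} * prob {\<omega> \<in> space M. \<forall>i<k. g \<omega> $ i \<le> d i}"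
proof -
  interpret PP: pair_prob_space M M ..
  note [measurable] = random_vec_index[OF f] random_vec_index[OF g]
  define U where "U i \<omega> = (if i < n then f \<omega> $ i else g \<omega> $ (i - n))" for i \<omega>
  define V where "V i y = (if i < n then f (fst y) $ i else g (snd y) $ (i - n))" for i y
  define A where "A i = (if i < n then {..c i} else {..d (i - n)})" for i
  have "measure M {\<omega> \<in> space M. \<forall>i<n+k. U i \<omega> \<in> A i} =
    measure (M \<Otimes>\<^sub>M M) {y \<in> space (M \<Otimes>\<^sub>M M). \<forall>i<n+k. V i y \<in> A i}"
  proof (rule char_determines_boxes[OF finite_measure_axioms PP.finite_measure_axioms])
    show "U i \<in> borel_measurable M" for i unfolding U_def by measurable
    show "V i \<in> borel_measurable (M \<Otimes>\<^sub>M M)" for i unfolding V_def by measurable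
    show "A i \<in> sets borel" for i unfolding A_def by simp
    fix t :: "nat \<Rightarrow> real"
    define a where "a = vec n t"
    define b where "b = vec k (\<lambda>i. t (n + i))"
    have ab: "a \<in> carrier_vec n" "b \<in> carrier_vec k" by (simp_all add: a_def b_def)
    have "(\<integral>\<omega>. iexp (\<Sum>i<n+k. t i * U i \<omega>) \<partial>M) = (\<integral>\<omega>. iexp (a \<bullet> f \<omega> + b \<bullet> g \<omega>) \<partial>M)"
      unfolding a_def b_def U_def
      by (intro Bochner_Integration.integral_cong refl)
        (simp only: sum_split_coordinates[OF random_vec_carrier[OF f] random_vec_carrier[OF g]])
    also have "\<dots> = (\<integral>\<omega>. iexp (a \<bullet> f \<omega>) \<partial>M) * (\<integral>\<omega>. iexp (b \<bullet> g \<omega>) \<partial>M)"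
      by (rule fac[OF ab])
    also have "\<dots> = (\<integral>y. iexp (a \<bullet> f (fst y) + b \<bullet> g (snd y)) \<partial>(M \<Otimes>\<^sub>M M))"
      using iexp_integral_pair[OF random_vec_scalar_prod[OF f, of a] random_vec_scalar_prod[OF g, of b]] by simp
    also have "\<dots> = (\<integral>y. iexp (\<Sum>i<n+k. t i * V i y) \<partial>(M \<Otimes>\<^sub>M M))"
      unfolding a_def b_def V_def
      by (intro Bochner_Integration.integral_cong refl, subst sum_split_coordinates)
        (auto simp: space_pair_measure intro: random_vec_carrier[OF f] random_vec_carrier[OF g])
    finally show "(\<integral>\<omega>. iexp (\<Sum>i<n+k. t i * U i \<omega>) \<partial>M) =
      (\<integral>y. iexp (\<Sum>i<n+k. t i * V i y) \<partial>(M \<Otimes>\<^sub>M M))" .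
  qed
  moreover have split: "(\<forall>i<n+k. (if i < n then v $ i else w $ (i - n)) \<in> A i) \<longleftrightarrow>
    (\<forall>i<n. v $ i \<le> c i) \<and> (\<forall>i<k. w $ i \<le> d i)" for v w :: "real vec"
  proof (intro iffI conjI allI impI)
    fix i assume *: "\<forall>i<n+k. (if i < n then v $ i else w $ (i - n)) \<in> A i"
    show "v $ i \<le> c i" if "i < n" using *[rule_format, of i] that by (simp add: A_def)
    show "w $ i \<le> d i" if "i < k" using *[rule_format, of "n + i"] that by (simp add: A_def)
  next
    fix i assume "(\<forall>i<n. v $ i \<le> c i) \<and> (\<forall>i<k. w $ i \<le> d i)" "i < n + k"
    then show "(if i < n then v $ i else w $ (i - n)) \<in> A i" by (auto simp: A_def)
  qed
  moreover have "{\<omega> \<in> space M. \<forall>i<n+k. U i \<omega> \<in> A i} =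
    {\<omega> \<in> space M. \<forall>i<n. f \<omega> $ i \<le> c i} \<inter> {\<omega> \<in> space M. \<forall>i<k. g \<omega> $ i \<le> d i}"
    unfolding U_def split by auto
  moreover have "{y \<in> space (M \<Otimes>\<^sub>M M). \<forall>i<n+k. V i y \<in> A i} =
    {\<omega> \<in> space M. \<forall>i<n. f \<omega> $ i \<le> c i} \<times> {\<omega> \<in> space M. \<forall>i<k. g \<omega> $ i \<le> d i}"
    unfolding V_def split by (auto simp: space_pair_measure)
  moreover have "measure (M \<Otimes>\<^sub>M M) ({\<omega> \<in> space M. \<forall>i<n. f \<omega> $ i \<le> c i} \<times> {\<omega> \<in> space M. \<forall>i<k. g \<omega> $ i \<le> d i}) =
    prob {\<omega> \<in> space M. \<forall>i<n. f \<omega> $ i \<le> c i} * prob {\<omega> \<in> space M. \<forall>i<k. g \<omega> $ i \<le> d i}"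
    by (subst measure_def, subst emeasure_pair_measure_Times) (simp_all add: enn2real_mult measure_def)
  ultimately show ?thesis by simp
qed

lemma random_vec_orthant_sets:
  assumes "random_vec M n f"
  shows "{\<omega> \<in> space M. \<forall>i<n. f \<omega> $ i \<le> c i} \<in> sets M"
  using random_vec_index[OF assms] by measurable

text \<open>Preimages of generators generate the preimages of all measurable sets, and among the
  generators only orthants of dimension n have nonempty preimage.\<close>

lemma random_vec_preimage_generated:
  assumes f: "random_vec M n f" and A: "A \<in> sets vec_borel"
  shows "f -` A \<inter> space M \<in> sigma_sets (space M) (range (\<lambda>c. {\<omega> \<in> space M. \<forall>i<n. f \<omega> $ i \<le> c i}))"
proof -
  let ?G = "range (\<lambda>c. {\<omega> \<in> space M. \<forall>i<n. f \<omega> $ i \<le> c i})"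
  have G: "?G \<subseteq> Pow (space M)" by auto
  have "f \<in> measurable (sigma (space M) ?G) vec_borel"
    unfolding vec_borel_def
  proof (rule measurable_measure_of, safe)
    fix d and c :: "real vec" assume "c \<in> carrier_vec d"
    have "f -` {v \<in> carrier_vec d. \<forall>i<d. v $ i \<le> c $ i} \<inter> space M =
      (if d = n then {\<omega> \<in> space M. \<forall>i<n. f \<omega> $ i \<le> c $ i} else {})"
      using random_vec_carrier[OF f] unfolding carrier_vec_def by auto
    moreover have "{\<omega> \<in> space M. \<forall>i<n. f \<omega> $ i \<le> c $ i} \<in> sigma_sets (space M) ?G"
      by (rule sigma_sets.Basic) blast
    ultimately show "f -` {v \<in> carrier_vec d. \<forall>i<d. v $ i \<le> c $ i} \<inter> space (sigma (space M) ?G)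
        \<in> sets (sigma (space M) ?G)"
      using G by (simp add: sigma_sets.Empty)
  qed simp_all
  from measurable_sets[OF this A] G show ?thesis by simp
qed

text \<open>Two orthants meet in the orthant of the minima of their bounds, so the orthant events
  form a \<pi>-system and their independence extends to the generated \<sigma>-algebras.\<close>

lemma (in prob_space) char_factor_imp_indep:
  assumes f: "random_vec M n f" and g: "random_vec M k g"
    and fac: "\<And>a b. a \<in> carrier_vec n \<Longrightarrow> b \<in> carrier_vec k \<Longrightarrow>
      (\<integral>\<omega>. iexp (a \<bullet> f \<omega> + b \<bullet> g \<omega>) \<partial>M) = (\<integral>\<omega>. iexp (a \<bullet> f \<omega>) \<partial>M) * (\<integral>\<omega>. iexp (b \<bullet> g \<omega>) \<partial>M)"
  shows "indep_var vec_borel f vec_borel g"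
proof -
  let ?G = "\<lambda>n f. range (\<lambda>c. {\<omega> \<in> space M. \<forall>i<n. f \<omega> $ i \<le> c i})"
  have stable: "Int_stable (?G n f)" for n and f :: "'a \<Rightarrow> real vec"
  proof (rule Int_stableI, safe)
    fix c d :: "nat \<Rightarrow> real"
    have "{\<omega> \<in> space M. \<forall>i<n. f \<omega> $ i \<le> c i} \<inter> {\<omega> \<in> space M. \<forall>i<n. f \<omega> $ i \<le> d i} =
      {\<omega> \<in> space M. \<forall>i<n. f \<omega> $ i \<le> min (c i) (d i)}" by auto
    then show "{\<omega> \<in> space M. \<forall>i<n. f \<omega> $ i \<le> c i} \<inter> {\<omega> \<in> space M. \<forall>i<n. f \<omega> $ i \<le> d i} \<in> ?G n f"
      by (simp only:) (rule rangeI)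
  qed
  have "indep_set (?G n f) (?G k g)"
  proof (rule indep_setI)
    show "?G n f \<subseteq> events" by (intro image_subsetI random_vec_orthant_sets[OF f])
    show "?G k g \<subseteq> events" by (intro image_subsetI random_vec_orthant_sets[OF g])
    show "prob (a \<inter> b) = prob a * prob b" if "a \<in> ?G n f" "b \<in> ?G k g" for a b
      using that char_factor_imp_indep_orthants[OF f g fac] by (elim rangeE) (simp only:)
  qed
  then have ind: "indep_set (sigma_sets (space M) (?G n f)) (sigma_sets (space M) (?G k g))"
    using stable stable by (rule indep_set_sigma_sets)
  show ?thesis
    unfolding indep_var_eq
  proof (intro conjI random_vec_measurable[OF f] random_vec_measurable[OF g])
    show "indep_set (sigma_sets (space M) {f -` A \<inter> space M |A. A \<in> sets vec_borel})
      (sigma_sets (space M) {g -` A \<inter> space M |A. A \<in> sets vec_borel})"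
    proof (rule indep_setI)
      fix a b
      assume ab: "a \<in> sigma_sets (space M) {f -` A \<inter> space M |A. A \<in> sets vec_borel}"
        "b \<in> sigma_sets (space M) {g -` A \<inter> space M |A. A \<in> sets vec_borel}"
      have "sigma_sets (space M) {f -` A \<inter> space M |A. A \<in> sets vec_borel} \<subseteq> sigma_sets (space M) (?G n f)"
        using random_vec_preimage_generated[OF f] by (intro sigma_sets_mono) auto
      moreover have "sigma_sets (space M) {g -` A \<inter> space M |A. A \<in> sets vec_borel} \<subseteq> sigma_sets (space M) (?G k g)"
        using random_vec_preimage_generated[OF g] by (intro sigma_sets_mono) auto
      ultimately show "prob (a \<inter> b) = prob a * prob b"
        using ab by (intro indep_setD[OF ind]) auto
    next
      show "sigma_sets (space M) {f -` A \<inter> space M |A. A \<in> sets vec_borel} \<subseteq> events"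
        using measurable_sets[OF random_vec_measurable[OF f]] by (intro sets.sigma_sets_subset) auto
      show "sigma_sets (space M) {g -` A \<inter> space M |A. A \<in> sets vec_borel} \<subseteq> events"
        using measurable_sets[OF random_vec_measurable[OF g]] by (intro sets.sigma_sets_subset) auto
    qed
  qed
qed

text \<open>A freezing lemma: given f, the selected value s (f) counts as a constant and g keeps its
  law. Since s takes finitely many values, the event splits into pieces where independence applies
  directly.\<close>

lemma (in prob_space) cond_probability_selection:
  assumes ind: "indep_var N1 f N2 g"
    and s: "\<And>\<omega>. \<omega> \<in> space M \<Longrightarrow> s (f \<omega>) \<in> I" and I: "finite I"
    and s_sets: "\<And>m. m \<in> I \<Longrightarrow> s -` {m} \<inter> space N1 \<in> sets N1"
    and B: "\<And>m. m \<in> I \<Longrightarrow> B m \<in> sets N2"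
  defines "E \<equiv> {\<omega> \<in> space M. g \<omega> \<in> B (s (f \<omega>))}"
  shows "E \<in> sets M"
    and "AE \<omega> in M. cond_probability M (generated_by M f N1) E \<omega> = prob (g -` B (s (f \<omega>)) \<inter> space M)"
proof -
  have f: "f \<in> measurable M N1" and g: "g \<in> measurable M N2"
    using ind by (auto dest: indep_var_rv1 indep_var_rv2)
  define F where "F = generated_by M f N1"
  have F: "F = vimage_algebra (space M) f N1" by (simp add: F_def generated_by_def)
  have sub: "subalgebra M F"
    unfolding subalgebra_def F using f
    by (auto simp: sets_vimage_algebra2 measurable_space measurable_sets)
  interpret F: finite_measure_subalgebra M F by unfold_locales (rule sub)
  define h where "h \<omega> = prob (g -` B (s (f \<omega>)) \<inter> space M)" for \<omega>
  \<comment> \<open>\<open>T m\<close> is the event that m is selected; it is decided by f and so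
    belongs to F.\<close>
  define T where "T m = f -` (s -` {m} \<inter> space N1) \<inter> space M" for m
  have T_F: "T m \<in> sets F" if "m \<in> I" for m
    unfolding T_def F using s_sets[OF that] by (rule in_vimage_algebra)
  have T_M: "T m \<in> sets M" if "m \<in> I" for m
    using T_F[OF that] sub by (auto simp: subalgebra_def)
  have T_iff: "\<omega> \<in> T m \<longleftrightarrow> s (f \<omega>) = m" if "\<omega> \<in> space M" for \<omega> m
    using that measurable_space[OF f that] by (auto simp: T_def)
  have gB: "g -` B m \<inter> space M \<in> sets M" if "m \<in> I" for m
    using measurable_sets[OF g B[OF that]] .
  have E_eq: "E = (\<Union>m\<in>I. T m \<inter> (g -` B m \<inter> space M))"
    unfolding E_def using s T_iff by (auto simp: T_def)
  show E: "E \<in> sets M"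
    unfolding E_eq using I by (rule sets.finite_UN) (rule sets.Int[OF T_M gB])
  \<comment> \<open>Each outcome selects exactly one m, so at most one summand is nonzero.\<close>
  have ind_sum: "indicator E \<omega> = (\<Sum>m\<in>I. indicator (T m \<inter> (g -` B m \<inter> space M)) \<omega> :: real)"
    if "\<omega> \<in> space M" for \<omega>
  proof -
    have "(\<Sum>m\<in>I. indicator (T m \<inter> (g -` B m \<inter> space M)) \<omega> :: real) =
      (\<Sum>m\<in>I. if m = s (f \<omega>) then indicator E \<omega> else 0)"
      using that by (intro sum.cong refl) (auto simp: indicator_def T_iff E_def)
    then show ?thesis using s[OF that] I by simp
  qed
  have h_sum: "h \<omega> = (\<Sum>m\<in>I. indicator (T m) \<omega> * prob (g -` B m \<inter> space M))" if "\<omega> \<in> space M" for \<omega>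
  proof -
    have "(\<Sum>m\<in>I. indicator (T m) \<omega> * prob (g -` B m \<inter> space M)) = (\<Sum>m\<in>I. if m = s (f \<omega>) then h \<omega> else 0)"
      using that by (intro sum.cong refl) (auto simp: indicator_def T_iff h_def)
    then show ?thesis using s[OF that] I by simp
  qed
  have spF: "space F = space M" using sub by (simp add: subalgebra_def)
  \<comment> \<open>\<open>h\<close> depends on the outcome only through which of the events
    \<open>T m\<close> occurs, and these lie in F.\<close>
  have hF: "h \<in> borel_measurable F"
  proof (subst measurable_cong[where g = "\<lambda>\<omega>. \<Sum>m\<in>I. indicator (T m) \<omega> * prob (g -` B m \<inter> space M)"])
    show "h \<omega> = (\<Sum>m\<in>I. indicator (T m) \<omega> * prob (g -` B m \<inter> space M))" if "\<omega> \<in> space F" for \<omega>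
      using h_sum that spF by simp
    show "(\<lambda>\<omega>. \<Sum>m\<in>I. indicator (T m) \<omega> * prob (g -` B m \<inter> space M)) \<in> borel_measurable F"
      using T_F by (intro borel_measurable_sum borel_measurable_times borel_measurable_indicator borel_measurable_const) auto
  qed
  have hM: "h \<in> borel_measurable M" by (rule measurable_from_subalg[OF sub hF])
  have "AE \<omega> in M. real_cond_exp M F (indicator E) \<omega> = h \<omega>"
  proof (rule F.real_cond_exp_charact)
    show "integrable M (indicator E :: _ \<Rightarrow> real)"
      by (rule integrable_const_bound[where B = 1]) (use E in \<open>auto simp: indicator_def\<close>)
    show "integrable M h"
      by (rule integrable_const_bound[where B = 1]) (use hM in \<open>auto simp: h_def\<close>)
    fix A assume "A \<in> sets F"
    then obtain A' where A': "A' \<in> sets N1" "A = f -` A' \<inter> space M"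
      unfolding F using f by (auto simp: sets_vimage_algebra2 measurable_space)
    have A: "A \<in> sets M" unfolding A'(2) using measurable_sets[OF f A'(1)] .
    \<comment> \<open>Both A and \<open>T m\<close> are events about f, hence so is their
      intersection, which is therefore independent of g.\<close>
    have prodm: "prob (A \<inter> T m \<inter> (g -` B m \<inter> space M)) = prob (A \<inter> T m) * prob (g -` B m \<inter> space M)"
      if m: "m \<in> I" for m
    proof -
      have "A' \<inter> (s -` {m} \<inter> space N1) \<in> sets N1" using A'(1) s_sets[OF m] by simp
      from indep_varD[OF ind this B[OF m]]
      have "prob ((\<lambda>x. (f x, g x)) -` ((A' \<inter> (s -` {m} \<inter> space N1)) \<times> B m) \<inter> space M) =
        prob (f -` (A' \<inter> (s -` {m} \<inter> space N1)) \<inter> space M) * prob (g -` B m \<inter> space M)" .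
      moreover have "(\<lambda>x. (f x, g x)) -` ((A' \<inter> (s -` {m} \<inter> space N1)) \<times> B m) \<inter> space M =
        A \<inter> T m \<inter> (g -` B m \<inter> space M)"
        unfolding A'(2) T_def by auto
      moreover have "f -` (A' \<inter> (s -` {m} \<inter> space N1)) \<inter> space M = A \<inter> T m"
        unfolding A'(2) T_def by auto
      ultimately show ?thesis by simp
    qed
    have int_ind: "integrable M (indicator D :: _ \<Rightarrow> real)" if "D \<in> sets M" for D
      by (rule integrable_const_bound[where B = 1]) (use that in \<open>auto simp: indicator_def\<close>)
    have AT: "A \<inter> T m \<in> sets M" if "m \<in> I" for m
      using A T_M[OF that] by (rule sets.Int)
    have AB: "A \<inter> T m \<inter> (g -` B m \<inter> space M) \<in> sets M" if "m \<in> I" for m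
      using AT[OF that] gB[OF that] by (rule sets.Int)
    have "(LINT \<omega>:A|M. indicator E \<omega> :: real) =
        (\<integral>\<omega>. (\<Sum>m\<in>I. indicator (A \<inter> T m \<inter> (g -` B m \<inter> space M)) \<omega>) \<partial>M)"
      unfolding set_lebesgue_integral_def
      by (intro Bochner_Integration.integral_cong refl)
        (simp add: ind_sum sum_distrib_left indicator_inter_arith mult.assoc)
    also have "\<dots> = (\<Sum>m\<in>I. prob (A \<inter> T m \<inter> (g -` B m \<inter> space M)))"
      using AB int_ind sets.sets_into_space[OF AB]
      by (subst Bochner_Integration.integral_sum) (simp_all add: Int_absorb2 cong: sum.cong)
    also have "\<dots> = (\<Sum>m\<in>I. prob (A \<inter> T m) * prob (g -` B m \<inter> space M))"
      using prodm by (rule sum.cong[OF refl])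
    also have "\<dots> = (\<integral>\<omega>. (\<Sum>m\<in>I. indicator (A \<inter> T m) \<omega> * prob (g -` B m \<inter> space M)) \<partial>M)"
      using AT int_ind sets.sets_into_space[OF AT]
      by (subst Bochner_Integration.integral_sum) (simp_all add: Int_absorb2 cong: sum.cong)
    also have "\<dots> = (LINT \<omega>:A|M. h \<omega>)"
      unfolding set_lebesgue_integral_def
      by (intro Bochner_Integration.integral_cong refl)
        (simp add: h_sum sum_distrib_left indicator_inter_arith mult.assoc)
    finally show "(LINT \<omega>:A|M. indicator E \<omega> :: real) = (LINT \<omega>:A|M. h \<omega>)" .
  qed (rule hF)
  then show "AE \<omega> in M. cond_probability M (generated_by M f N1) E \<omega> = prob (g -` B (s (f \<omega>)) \<inter> space M)"
    by (simp add: cond_probability_def F_def h_def)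
qed

section \<open>Data fission\<close>

lemma covariance_form_nonneg:
  "covariance_mat d S \<Longrightarrow> a \<in> carrier_vec d \<Longrightarrow> 0 \<le> a \<bullet> (S *\<^sub>v a)"
  by (simp add: covariance_mat_def)

lemma covariance_form_combination:
  fixes S :: "real mat"
  assumes S: "S \<in> carrier_mat d d" "transpose_mat S = S"
    and a: "a \<in> carrier_vec d" and b: "b \<in> carrier_vec d"
  shows "(r \<cdot>\<^sub>v a + s \<cdot>\<^sub>v b) \<bullet> (S *\<^sub>v (r \<cdot>\<^sub>v a + s \<cdot>\<^sub>v b)) =
    r\<^sup>2 * (a \<bullet> (S *\<^sub>v a)) + 2 * r * s * (a \<bullet> (S *\<^sub>v b)) + s\<^sup>2 * (b \<bullet> (S *\<^sub>v b))"
proof -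
  have Sa: "S *\<^sub>v a \<in> carrier_vec d" and Sb: "S *\<^sub>v b \<in> carrier_vec d"
    using S(1) a b by auto
  have sym: "b \<bullet> (S *\<^sub>v a) = a \<bullet> (S *\<^sub>v b)"
    using transpose_vec_mult_scalar[OF S(1) a b] S(2) comm_scalar_prod[OF Sb a] by simp
  have "S *\<^sub>v (r \<cdot>\<^sub>v a + s \<cdot>\<^sub>v b) = r \<cdot>\<^sub>v (S *\<^sub>v a) + s \<cdot>\<^sub>v (S *\<^sub>v b)"
    using mult_add_distrib_mat_vec[OF S(1), of "r \<cdot>\<^sub>v a" "s \<cdot>\<^sub>v b"] a b
      mult_mat_vec[OF S(1) a] mult_mat_vec[OF S(1) b] by simp
  then show ?thesis
    using a b Sa Sb sym
    by (simp add: add_scalar_prod_distrib[of _ d] scalar_prod_add_distrib[of _ d] power2_eq_square algebra_simps)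
qed

lemma (in prob_space) mvn_linear_form:
  assumes W: "random_vec M d W" "mvn_law d (distr M vec_borel W) m S" and a: "a \<in> carrier_vec d"
  shows "distr M borel (\<lambda>\<omega>. a \<bullet> W \<omega>) = normal_law (a \<bullet> m) (a \<bullet> (S *\<^sub>v a))"
    and "0 \<le> a \<bullet> (S *\<^sub>v a)"
proof -
  have "distr (distr M vec_borel W) borel (\<lambda>v. a \<bullet> v) = distr M borel (\<lambda>\<omega>. a \<bullet> W \<omega>)"
    using distr_distr[OF measurable_scalar_prod random_vec_measurable[OF W(1)]] by (simp add: comp_def)
  then show "distr M borel (\<lambda>\<omega>. a \<bullet> W \<omega>) = normal_law (a \<bullet> m) (a \<bullet> (S *\<^sub>v a))"
    using W(2) a by (simp add: mvn_law_def)
  show "0 \<le> a \<bullet> (S *\<^sub>v a)"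
    using W(2) a by (auto simp: mvn_law_def intro: covariance_form_nonneg)
qed

text \<open>The multivariate characteristic function at a is the univariate one of the linear form a
  at frequency 1.\<close>

lemma (in prob_space) mvn_char:
  assumes W: "random_vec M d W" "mvn_law d (distr M vec_borel W) m S" and a: "a \<in> carrier_vec d"
  shows "(\<integral>\<omega>. iexp (a \<bullet> W \<omega>) \<partial>M) = iexp (a \<bullet> m) * exp (- (a \<bullet> (S *\<^sub>v a)) / 2)"
proof -
  have "(\<integral>\<omega>. iexp (a \<bullet> W \<omega>) \<partial>M) = char (distr M borel (\<lambda>\<omega>. a \<bullet> W \<omega>)) 1"
    unfolding char_def using random_vec_scalar_prod[OF W(1), of a] by (subst integral_distr) simp_all
  then show ?thesis
    using mvn_linear_form[OF W a] char_normal_law[of "a \<bullet> (S *\<^sub>v a)" "a \<bullet> m" 1] by simp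
qed

lemma (in prob_space) mvn_moments:
  assumes W: "random_vec M d W" "mvn_law d (distr M vec_borel W) m S" and a: "a \<in> carrier_vec d"
  shows "integrable M (\<lambda>\<omega>. a \<bullet> W \<omega>)" "expectation (\<lambda>\<omega>. a \<bullet> W \<omega>) = a \<bullet> m"
    "integrable M (\<lambda>\<omega>. (a \<bullet> W \<omega>)\<^sup>2)"
proof -
  note L = mvn_linear_form[OF W a]
  note N = normal_law_second_moment[OF L(2), of "a \<bullet> m", folded L(1)]
  have meas: "(\<lambda>\<omega>. a \<bullet> W \<omega>) \<in> borel_measurable M" by (rule random_vec_scalar_prod[OF W(1)])
  show "integrable M (\<lambda>\<omega>. a \<bullet> W \<omega>)" by (rule integrable_distr[OF meas N(1)])
  show "integrable M (\<lambda>\<omega>. (a \<bullet> W \<omega>)\<^sup>2)" by (rule integrable_distr[OF meas N(3)])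
  show "expectation (\<lambda>\<omega>. a \<bullet> W \<omega>) = a \<bullet> m"
    using N(2) integral_distr[OF meas, of "\<lambda>x. x"] by simp
qed

text \<open>The cross term has mean zero because W is centred. Integrability must be proved, as the
  integral of a nonintegrable function is 0 by convention.\<close>

lemma (in prob_space) expected_sq_norm_shift:
  assumes W: "random_vec M d W" "mvn_law d (distr M vec_borel W) (0\<^sub>v d) S" and c: "c \<in> carrier_vec d"
  shows "expectation (\<lambda>\<omega>. sq_norm (W \<omega> - c)) = expectation (\<lambda>\<omega>. sq_norm (W \<omega>)) + sq_norm c"
proof -
  have coord: "unit_vec d i \<bullet> W \<omega> = W \<omega> $ i" if "\<omega> \<in> space M" "i < d" for \<omega> i
    using random_vec_carrier[OF W(1) that(1)] that(2) by simp
  have "integrable M (\<lambda>\<omega>. \<Sum>i<d. (unit_vec d i \<bullet> W \<omega>)\<^sup>2)"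
    by (intro Bochner_Integration.integrable_sum mvn_moments(3)[OF W]) simp
  moreover have "sq_norm (W \<omega>) = (\<Sum>i<d. (unit_vec d i \<bullet> W \<omega>)\<^sup>2)" if "\<omega> \<in> space M" for \<omega>
    using carrier_vecD[OF random_vec_carrier[OF W(1) that]] coord[OF that]
    by (simp add: sq_norm_def scalar_prod_def[of "W \<omega>"] atLeast0LessThan power2_eq_square)
  ultimately have i2: "integrable M (\<lambda>\<omega>. sq_norm (W \<omega>))"
    by (simp cong: Bochner_Integration.integrable_cong)
  have i1: "integrable M (\<lambda>\<omega>. c \<bullet> W \<omega>)" and e1: "expectation (\<lambda>\<omega>. c \<bullet> W \<omega>) = 0"
    using mvn_moments[OF W c] c by simp_all
  have "expectation (\<lambda>\<omega>. sq_norm (W \<omega> - c)) = expectation (\<lambda>\<omega>. (sq_norm (W \<omega>) - 2 * (c \<bullet> W \<omega>)) + sq_norm c)"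
  proof (intro Bochner_Integration.integral_cong refl)
    fix \<omega> assume "\<omega> \<in> space M"
    from random_vec_carrier[OF W(1) this]
    show "sq_norm (W \<omega> - c) = (sq_norm (W \<omega>) - 2 * (c \<bullet> W \<omega>)) + sq_norm c"
      using c sq_norm_minus[of "W \<omega>" d c] comm_scalar_prod[of "W \<omega>" d c] by simp
  qed
  also have "\<dots> = expectation (\<lambda>\<omega>. sq_norm (W \<omega>)) + sq_norm c"
    using i1 i2 e1 prob_space by simp
  finally show ?thesis .
qed

text \<open>The probabilistic setting without design matrix and selection: f and g are shown
  independent before any model is considered.\<close>

locale data_fission = prob_space P for P :: "'w measure" +
  fixes n :: nat and Sigma :: "real mat" and \<mu> :: "real vec"
    and \<epsilon> Y Z fY gY :: "'w \<Rightarrow> real vec" and \<tau> :: real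
  assumes mu: "\<mu> \<in> carrier_vec n" and Sigma: "covariance_mat n Sigma"
    and eps: "random_vec P n \<epsilon>" "mvn_law n (distr P vec_borel \<epsilon>) (0\<^sub>v n) Sigma"
    and Y: "Y = (\<lambda>\<omega>. \<mu> + \<epsilon> \<omega>)"
    and Z: "random_vec P n Z" "mvn_law n (distr P vec_borel Z) (0\<^sub>v n) Sigma"
    and indep: "indep_var vec_borel Y vec_borel Z"
    and tau: "\<tau> > 0"
    and fY: "fY = (\<lambda>\<omega>. Y \<omega> + \<tau> \<cdot>\<^sub>v Z \<omega>)"
    and gY: "gY = (\<lambda>\<omega>. Y \<omega> - (1 / \<tau>) \<cdot>\<^sub>v Z \<omega>)"
begin

lemma Y_random: "random_vec P n Y"
  unfolding Y by (rule random_vec_const_add[OF eps(1) mu])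

lemma fY_random: "random_vec P n fY"
  unfolding fY by (rule random_vec_add_smult[OF Y_random Z(1)])

text \<open>Written as a sum, g has the same shape as f, with noise scale -1/\<tau> instead of
  \<tau>.\<close>

lemma gY_eq: "\<omega> \<in> space P \<Longrightarrow> gY \<omega> = Y \<omega> + (- 1 / \<tau>) \<cdot>\<^sub>v Z \<omega>"
  unfolding gY using random_vec_carrier[OF Y_random] random_vec_carrier[OF Z(1)]
  by (intro eq_vecI) (auto dest!: carrier_vecD)

lemma gY_random: "random_vec P n gY"
proof -
  have "random_vec P n (\<lambda>\<omega>. Y \<omega> + (- 1 / \<tau>) \<cdot>\<^sub>v Z \<omega>)"
    by (rule random_vec_add_smult[OF Y_random Z(1)])
  then show ?thesis
    unfolding random_vec_def using gY_eq by (simp cong: measurable_cong)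
qed

abbreviation q :: "real vec \<Rightarrow> real" where
  "q a \<equiv> a \<bullet> (Sigma *\<^sub>v a)"

lemma Y_char:
  assumes a: "a \<in> carrier_vec n"
  shows "(\<integral>\<omega>. iexp (a \<bullet> Y \<omega>) \<partial>P) = iexp (a \<bullet> \<mu>) * exp (- q a / 2)"
proof -
  have "(\<integral>\<omega>. iexp (a \<bullet> Y \<omega>) \<partial>P) = (\<integral>\<omega>. iexp (a \<bullet> \<mu>) * iexp (a \<bullet> \<epsilon> \<omega>) \<partial>P)"
  proof (intro Bochner_Integration.integral_cong refl)
    fix \<omega> assume "\<omega> \<in> space P"
    from random_vec_carrier[OF eps(1) this]
    have "a \<bullet> Y \<omega> = a \<bullet> \<mu> + a \<bullet> \<epsilon> \<omega>"
      unfolding Y using a mu by (simp add: scalar_prod_add_distrib[of _ n])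
    then show "iexp (a \<bullet> Y \<omega>) = iexp (a \<bullet> \<mu>) * iexp (a \<bullet> \<epsilon> \<omega>)"
      by (simp add: distrib_left exp_add)
  qed
  also have "\<dots> = iexp (a \<bullet> \<mu>) * (\<integral>\<omega>. iexp (a \<bullet> \<epsilon> \<omega>) \<partial>P)"
    by (rule integral_mult_right_zero)
  also have "(\<integral>\<omega>. iexp (a \<bullet> \<epsilon> \<omega>) \<partial>P) = exp (- q a / 2)"
    using mvn_char[OF eps a] a by simp
  finally show ?thesis .
qed

text \<open>
  The noise scales of f and g are chosen such that the mixed covariance terms from Y and from Z
  cancel.
\<close>

lemma fission_joint_char:
  assumes a: "a \<in> carrier_vec n" and b: "b \<in> carrier_vec n"
  shows "(\<integral>\<omega>. iexp (a \<bullet> fY \<omega> + b \<bullet> gY \<omega>) \<partial>P) =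
    (iexp (a \<bullet> \<mu>) * exp (- ((1 + \<tau>\<^sup>2) * q a) / 2)) * (iexp (b \<bullet> \<mu>) * exp (- ((1 + 1 / \<tau>\<^sup>2) * q b) / 2))"
proof -
  have exp_half_add: "exp (- (x + y) / 2) = exp (- x / 2) * exp (- y / 2)" for x y :: real
    by (simp add: exp_add[symmetric] add_divide_distrib diff_divide_distrib)
  \<comment> \<open>\<open>u\<close> and \<open>w\<close> collect the coefficients of Y and Z in the
    form a f + b g. The factors 1 in \<open>u\<close> give it the shape that
    \<open>covariance_form_combination\<close> expects.\<close>
  define u where "u = 1 \<cdot>\<^sub>v a + 1 \<cdot>\<^sub>v b"
  define w where "w = \<tau> \<cdot>\<^sub>v a + (- 1 / \<tau>) \<cdot>\<^sub>v b"
  have u: "u \<in> carrier_vec n" and w: "w \<in> carrier_vec n" using a b by (auto simp: u_def w_def)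
  have "(\<integral>\<omega>. iexp (a \<bullet> fY \<omega> + b \<bullet> gY \<omega>) \<partial>P) = (\<integral>\<omega>. iexp (u \<bullet> Y \<omega>) * iexp (w \<bullet> Z \<omega>) \<partial>P)"
  proof (intro Bochner_Integration.integral_cong refl)
    fix \<omega> assume \<omega>: "\<omega> \<in> space P"
    have y: "Y \<omega> \<in> carrier_vec n" and z: "Z \<omega> \<in> carrier_vec n"
      using random_vec_carrier[OF Y_random \<omega>] random_vec_carrier[OF Z(1) \<omega>] .
    have "a \<bullet> fY \<omega> + b \<bullet> gY \<omega> = u \<bullet> Y \<omega> + w \<bullet> Z \<omega>"
      unfolding gY_eq[OF \<omega>] fY u_def w_def using a b y z
      by (simp add: add_scalar_prod_distrib[of _ n] scalar_prod_add_distrib[of _ n])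
    then show "iexp (a \<bullet> fY \<omega> + b \<bullet> gY \<omega>) = iexp (u \<bullet> Y \<omega>) * iexp (w \<bullet> Z \<omega>)"
      by (simp add: distrib_left exp_add)
  qed
  also have "\<dots> = (\<integral>\<omega>. iexp (u \<bullet> Y \<omega>) \<partial>P) * (\<integral>\<omega>. iexp (w \<bullet> Z \<omega>) \<partial>P)"
  proof (rule indep_var_lebesgue_integral)
    have m: "(\<lambda>v. iexp (c \<bullet> v)) \<in> borel_measurable vec_borel" for c
      by measurable
    show "indep_var borel (\<lambda>\<omega>. iexp (u \<bullet> Y \<omega>)) borel (\<lambda>\<omega>. iexp (w \<bullet> Z \<omega>))"
      using indep_var_compose[OF indep m m, of u w] by (simp only: comp_def)
    show "complex_integrable P (\<lambda>\<omega>. iexp (u \<bullet> Y \<omega>))" "complex_integrable P (\<lambda>\<omega>. iexp (w \<bullet> Z \<omega>))"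
      using random_vec_scalar_prod[OF Y_random] random_vec_scalar_prod[OF Z(1)]
      by (auto intro!: iexp_integrable finite_measure_axioms)
  qed
  also have "\<dots> = (iexp (u \<bullet> \<mu>) * exp (- q u / 2)) * exp (- q w / 2)"
    using Y_char[OF u] mvn_char[OF Z w] w by simp
  also have "\<dots> = iexp (u \<bullet> \<mu>) * complex_of_real (exp (- (q u + q w) / 2))"
    unfolding exp_half_add by (simp add: mult.assoc)
  also have "u \<bullet> \<mu> = a \<bullet> \<mu> + b \<bullet> \<mu>"
    unfolding u_def using a b mu by (simp add: add_scalar_prod_distrib[of _ n])
  \<comment> \<open>The cross coefficients are 2 from \<open>u\<close> and 2 * \<tau> * (-1/\<tau>)
    = -2 from \<open>w\<close>; the squared scales leave 1 + \<tau>^2 and 1 + 1/\<tau>^2.\<close>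
  also have "q u + q w = (1 + \<tau>\<^sup>2) * q a + (1 + 1 / \<tau>\<^sup>2) * q b"
  proof -
    have S: "Sigma \<in> carrier_mat n n" "transpose_mat Sigma = Sigma"
      using Sigma by (simp_all add: covariance_mat_def)
    show ?thesis
      unfolding u_def w_def covariance_form_combination[OF S a b] using tau
      by (simp add: field_simps power2_eq_square)
  qed
  finally show ?thesis
    unfolding exp_half_add by (simp add: distrib_left exp_add)
qed

text \<open>A zero frequency vector for the other component reduces the joint characteristic
  function to a marginal one.\<close>

lemma fission_marginal_chars:
  assumes a: "a \<in> carrier_vec n"
  shows "(\<integral>\<omega>. iexp (a \<bullet> fY \<omega>) \<partial>P) = iexp (a \<bullet> \<mu>) * exp (- ((1 + \<tau>\<^sup>2) * q a) / 2)"
    and "(\<integral>\<omega>. iexp (a \<bullet> gY \<omega>) \<partial>P) = iexp (a \<bullet> \<mu>) * exp (- ((1 + 1 / \<tau>\<^sup>2) * q a) / 2)"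
proof -
  have z: "0\<^sub>v n \<in> carrier_vec n" by simp
  have S: "Sigma \<in> carrier_mat n n" using Sigma by (simp add: covariance_mat_def)
  have q0: "q (0\<^sub>v n) = 0" using S by simp
  have "(\<integral>\<omega>. iexp (a \<bullet> fY \<omega>) \<partial>P) = (\<integral>\<omega>. iexp (a \<bullet> fY \<omega> + 0\<^sub>v n \<bullet> gY \<omega>) \<partial>P)"
    using random_vec_carrier[OF gY_random] by (intro Bochner_Integration.integral_cong refl) simp
  then show "(\<integral>\<omega>. iexp (a \<bullet> fY \<omega>) \<partial>P) = iexp (a \<bullet> \<mu>) * exp (- ((1 + \<tau>\<^sup>2) * q a) / 2)"
    unfolding fission_joint_char[OF a z] q0 using mu by simp
  have "(\<integral>\<omega>. iexp (a \<bullet> gY \<omega>) \<partial>P) = (\<integral>\<omega>. iexp (0\<^sub>v n \<bullet> fY \<omega> + a \<bullet> gY \<omega>) \<partial>P)"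
    using random_vec_carrier[OF fY_random] by (intro Bochner_Integration.integral_cong refl) simp
  then show "(\<integral>\<omega>. iexp (a \<bullet> gY \<omega>) \<partial>P) = iexp (a \<bullet> \<mu>) * exp (- ((1 + 1 / \<tau>\<^sup>2) * q a) / 2)"
    unfolding fission_joint_char[OF z a] q0 using mu by simp
qed

lemma fission_indep: "indep_var vec_borel fY vec_borel gY"
  by (rule char_factor_imp_indep[OF fY_random gY_random])
    (simp only: fission_joint_char fission_marginal_chars)

text \<open>At frequency t the characteristic function of a linear form a is the multivariate one at
  t a, where \<open>q\<close> scales by t^2; the one-dimensional Levy theorem then identifies the
  law.\<close>

lemma gY_linear_form:
  assumes a: "a \<in> carrier_vec n"
  shows "distr P borel (\<lambda>\<omega>. a \<bullet> gY \<omega>) = normal_law (a \<bullet> \<mu>) ((1 + 1 / \<tau>\<^sup>2) * q a)"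
proof -
  have S: "Sigma \<in> carrier_mat n n" using Sigma by (simp add: covariance_mat_def)
  have v: "0 \<le> (1 + 1 / \<tau>\<^sup>2) * q a"
    using covariance_form_nonneg[OF Sigma a] by simp
  have meas: "(\<lambda>\<omega>. a \<bullet> gY \<omega>) \<in> borel_measurable P" by (rule random_vec_scalar_prod[OF gY_random])
  have "char (distr P borel (\<lambda>\<omega>. a \<bullet> gY \<omega>)) t = char (normal_law (a \<bullet> \<mu>) ((1 + 1 / \<tau>\<^sup>2) * q a)) t" for t
  proof -
    have ta: "t \<cdot>\<^sub>v a \<in> carrier_vec n" using a by simp
    have "char (distr P borel (\<lambda>\<omega>. a \<bullet> gY \<omega>)) t = (\<integral>\<omega>. iexp (t * (a \<bullet> gY \<omega>)) \<partial>P)"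
      unfolding char_def using meas by (subst integral_distr) simp_all
    also have "\<dots> = (\<integral>\<omega>. iexp ((t \<cdot>\<^sub>v a) \<bullet> gY \<omega>) \<partial>P)"
      using random_vec_carrier[OF gY_random] a
      by (intro Bochner_Integration.integral_cong refl) (simp add: smult_scalar_prod_distrib[of _ n])
    also have "\<dots> = iexp ((t \<cdot>\<^sub>v a) \<bullet> \<mu>) * exp (- ((1 + 1 / \<tau>\<^sup>2) * q (t \<cdot>\<^sub>v a)) / 2)"
      by (rule fission_marginal_chars(2)[OF ta])
    also have "q (t \<cdot>\<^sub>v a) = t\<^sup>2 * q a"
      using a S by (simp add: mult_mat_vec[OF S a] power2_eq_square)
    also have "(t \<cdot>\<^sub>v a) \<bullet> \<mu> = t * (a \<bullet> \<mu>)"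
      using a mu by simp
    finally show ?thesis
      unfolding char_normal_law[OF v] by (simp add: ac_simps)
  qed
  then show ?thesis
    by (intro Levy_uniqueness real_distribution_distr meas real_distribution_normal_law v ext)
qed

end

section \<open>Estimation in one fixed model\<close>

lemma measurable_ls_solution: "ls_solution X m \<in> measurable vec_borel vec_borel"
proof (rule measurable_into_vec_borel)
  fix v i
  \<comment> \<open>The product has as many entries as the matrix has rows, whatever the dimension
    of v; this matters since \<open>vec_borel\<close> contains vectors of every dimension.\<close>
  show "ls_solution X m v \<in> carrier_vec (dim_row (ls_mat X m))"
    by (rule carrier_vecI) (simp add: ls_solution_eq)
  assume "i < dim_row (ls_mat X m)"
  then have "(\<lambda>v. ls_solution X m v $ i) = (\<lambda>v. row (ls_mat X m) i \<bullet> v)"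
    by (simp add: ls_solution_eq fun_eq_iff)
  then show "(\<lambda>v. ls_solution X m v $ i) \<in> borel_measurable vec_borel" by simp
qed

text \<open>The expected loss is the loss at \<mu> plus the noise term E ||\<epsilon>||^2, which
  does not depend on b. So the problem is ordinary least squares with \<mu> as response.\<close>

lemma (in data_fission) beta_star_eq:
  assumes "full_rank_selection X n p m"
  shows "beta_star P Y X m = ls_solution X m \<mu>"
proof -
  interpret full_rank_selection X n p m by fact
  have shift: "(\<integral>\<omega>. sq_norm (Y \<omega> - cols_of X m *\<^sub>v b) \<partial>P) =
      expectation (\<lambda>\<omega>. sq_norm (\<epsilon> \<omega>)) + sq_norm (\<mu> - cols_of X m *\<^sub>v b)"
    if b: "b \<in> carrier_vec (card m)" for b
  proof -
    have Cb: "cols_of X m *\<^sub>v b \<in> carrier_vec n" using cols_carrier b by simp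
    then have c: "cols_of X m *\<^sub>v b - \<mu> \<in> carrier_vec n" using mu by simp
    have "(\<integral>\<omega>. sq_norm (Y \<omega> - cols_of X m *\<^sub>v b) \<partial>P) =
        expectation (\<lambda>\<omega>. sq_norm (\<epsilon> \<omega> - (cols_of X m *\<^sub>v b - \<mu>)))"
    proof (intro Bochner_Integration.integral_cong refl arg_cong[where f = sq_norm])
      fix \<omega> assume "\<omega> \<in> space P"
      from carrier_vecD[OF random_vec_carrier[OF eps(1) this]]
      show "Y \<omega> - cols_of X m *\<^sub>v b = \<epsilon> \<omega> - (cols_of X m *\<^sub>v b - \<mu>)"
        unfolding Y using carrier_vecD[OF Cb] carrier_vecD[OF mu] by (intro eq_vecI) auto
    qed
    also have "\<dots> = expectation (\<lambda>\<omega>. sq_norm (\<epsilon> \<omega>)) + sq_norm (cols_of X m *\<^sub>v b - \<mu>)"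
      by (rule expected_sq_norm_shift[OF eps c])
    also have "sq_norm (cols_of X m *\<^sub>v b - \<mu>) = sq_norm (\<mu> - cols_of X m *\<^sub>v b)"
      using sq_norm_minus[OF Cb mu] sq_norm_minus[OF mu Cb] comm_scalar_prod[OF Cb mu] by simp
    finally show ?thesis .
  qed
  show ?thesis
    unfolding beta_star_def
    by (intro arg_min_on_eqI ls_solution_carrier[OF mu])
      (simp add: shift ls_solution_carrier[OF mu] ls_solution_strict_min[OF mu])
qed

text \<open>A linear form a of the estimator A g is the linear form A^T a of g, whose law is
  known.\<close>

lemma (in data_fission) ls_solution_law:
  assumes "full_rank_selection X n p m"
  shows "mvn_law (card m) (distr P vec_borel (\<lambda>\<omega>. ls_solution X m (gY \<omega>)))
    (ls_solution X m \<mu>) (fission_var X m Sigma \<tau>)"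
    and "a \<in> carrier_vec (card m) \<Longrightarrow> distr P borel (\<lambda>\<omega>. a \<bullet> ls_solution X m (gY \<omega>)) =
      normal_law (a \<bullet> ls_solution X m \<mu>) (a \<bullet> (fission_var X m Sigma \<tau> *\<^sub>v a))"
proof -
  interpret full_rank_selection X n p m by fact
  interpret fission_covariance X n p m Sigma \<tau> by unfold_locales (rule Sigma)
  have meas: "(\<lambda>\<omega>. ls_solution X m (gY \<omega>)) \<in> measurable P vec_borel"
    using measurable_compose[OF random_vec_measurable[OF gY_random] measurable_ls_solution] .
  show form: "distr P borel (\<lambda>\<omega>. a \<bullet> ls_solution X m (gY \<omega>)) =
      normal_law (a \<bullet> ls_solution X m \<mu>) (a \<bullet> (fission_var X m Sigma \<tau> *\<^sub>v a))"
    if a: "a \<in> carrier_vec (card m)" for a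
  proof -
    define b where "b = transpose_mat (ls_mat X m) *\<^sub>v a"
    have b: "b \<in> carrier_vec n" unfolding b_def using ls_mat_carrier a by simp
    have dual: "a \<bullet> ls_solution X m y = b \<bullet> y" if "y \<in> carrier_vec n" for y
      unfolding ls_solution_eq b_def using transpose_vec_mult_scalar[OF ls_mat_carrier that a] by simp
    have "distr P borel (\<lambda>\<omega>. a \<bullet> ls_solution X m (gY \<omega>)) = distr P borel (\<lambda>\<omega>. b \<bullet> gY \<omega>)"
      using dual random_vec_carrier[OF gY_random] by (intro distr_cong) auto
    then show ?thesis
      unfolding dual[OF mu] fission_var_form[OF a] using gY_linear_form[OF b] by (simp add: b_def)
  qed
  have "\<forall>a\<in>carrier_vec (card m). distr (distr P vec_borel (\<lambda>\<omega>. ls_solution X m (gY \<omega>))) borel (\<lambda>v. a \<bullet> v) =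
      normal_law (a \<bullet> ls_solution X m \<mu>) (a \<bullet> (fission_var X m Sigma \<tau> *\<^sub>v a))"
    using form distr_distr[OF measurable_scalar_prod meas] by (simp add: comp_def)
  moreover have "AE v in distr P vec_borel (\<lambda>\<omega>. ls_solution X m (gY \<omega>)). v \<in> carrier_vec (card m)"
    using ls_solution_carrier random_vec_carrier[OF gY_random] carrier_vec_in_vec_borel[of "card m"]
    by (subst AE_distr_iff[OF meas]) auto
  ultimately show "mvn_law (card m) (distr P vec_borel (\<lambda>\<omega>. ls_solution X m (gY \<omega>)))
    (ls_solution X m \<mu>) (fission_var X m Sigma \<tau>)"
    unfolding mvn_law_def
    using ls_solution_carrier[OF mu] fission_var_covariance prob_space_distr[OF meas] by simp
qed

text \<open>The random interval around the estimate contains the target exactly when the estimate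
  lies in the fixed interval of the same half-width around the target.\<close>

lemma (in data_fission) ls_interval_coverage:
  fixes \<alpha> :: real
  assumes "full_rank_selection X n p m" and \<alpha>: "0 < \<alpha>" "\<alpha> < 1" and k: "k < card m"
  defines "h \<equiv> normal_upper_quantile (\<alpha> / 2) * sqrt (fission_var X m Sigma \<tau> $$ (k, k))"
  shows "prob {\<omega> \<in> space P. ls_solution X m \<mu> $ k \<in>
      {ls_solution X m (gY \<omega>) $ k - h..ls_solution X m (gY \<omega>) $ k + h}} =
    (if fission_var X m Sigma \<tau> $$ (k, k) = 0 then 1 else 1 - \<alpha>)"
proof -
  interpret full_rank_selection X n p m by fact
  interpret fission_covariance X n p m Sigma \<tau> by unfold_locales (rule Sigma)
  let ?u = "unit_vec (card m) k :: real vec" and ?v = "fission_var X m Sigma \<tau> $$ (k, k)"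
  let ?b = "ls_solution X m \<mu> $ k"
  have u: "?u \<in> carrier_vec (card m)" by simp
  have v: "0 \<le> ?v"
    using covariance_form_nonneg[OF fission_var_covariance u] fission_var_diag[OF k] by simp
  have meas: "(\<lambda>\<omega>. ?u \<bullet> ls_solution X m (gY \<omega>)) \<in> borel_measurable P"
    using measurable_compose[OF measurable_compose[OF random_vec_measurable[OF gY_random]
        measurable_ls_solution] measurable_scalar_prod] .
  have coord: "?u \<bullet> ls_solution X m y = ls_solution X m y $ k" if "y \<in> carrier_vec n" for y
    using ls_solution_carrier[OF that] k by simp
  have law: "distr P borel (\<lambda>\<omega>. ?u \<bullet> ls_solution X m (gY \<omega>)) = normal_law ?b ?v"
    using ls_solution_law(2)[OF assms(1) u] coord[OF mu] fission_var_diag[OF k] by simp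
  have "{\<omega> \<in> space P. ?b \<in> {ls_solution X m (gY \<omega>) $ k - h..ls_solution X m (gY \<omega>) $ k + h}} =
      (\<lambda>\<omega>. ?u \<bullet> ls_solution X m (gY \<omega>)) -` {?b - h..?b + h} \<inter> space P"
    using coord[OF random_vec_carrier[OF gY_random]] by auto
  then have "prob {\<omega> \<in> space P. ?b \<in> {ls_solution X m (gY \<omega>) $ k - h..ls_solution X m (gY \<omega>) $ k + h}} =
      measure (normal_law ?b ?v) {?b - h..?b + h}"
    unfolding law[symmetric] using meas by (simp add: measure_distr)
  then show ?thesis
    unfolding h_def normal_law_central_interval[OF \<alpha> v] .
qed

text \<open>Coverage is exactly 1 - \<alpha> where the variance is positive and at least 1 -
  \<alpha> in general; the last conjunct shows that a positive definite \<open>Sigma\<close> always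
  falls under the exact case. The event \<open>covered\<close> includes k < card (M), because the
  number of coefficients is random.\<close>

theorem theorem2:
  fixes P :: "'w measure"
    and n p :: nat
    and X Sigma :: "real mat"
    and \<mu> :: "real vec"
    and \<epsilon> Y Z fY gY :: "'w \<Rightarrow> real vec"
    and select :: "real vec \<Rightarrow> nat set"
    and M :: "'w \<Rightarrow> nat set"
    and \<tau> \<alpha> :: real
  assumes prob: "prob_space P"
    and X: "X \<in> carrier_mat n p"
    and mu: "\<mu> \<in> carrier_vec n"
    and Sigma: "covariance_mat n Sigma"
    and eps: "random_vec P n \<epsilon>" "mvn_law n (distr P vec_borel \<epsilon>) (0\<^sub>v n) Sigma"
    and Y: "Y = (\<lambda>\<omega>. \<mu> + \<epsilon> \<omega>)"
    and Z: "random_vec P n Z" "mvn_law n (distr P vec_borel Z) (0\<^sub>v n) Sigma"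
    and indep: "prob_space.indep_var P vec_borel Y vec_borel Z"
    and tau: "\<tau> > 0"
    and fY: "fY = (\<lambda>\<omega>. Y \<omega> + \<tau> \<cdot>\<^sub>v Z \<omega>)"
    and gY: "gY = (\<lambda>\<omega>. Y \<omega> - (1 / \<tau>) \<cdot>\<^sub>v Z \<omega>)"
    and select: "select \<in> measurable vec_borel (count_space (Pow {..<p}))"
    and M: "M = (\<lambda>\<omega>. select (fY \<omega>))"
    and invertible: "\<And>\<omega>. \<omega> \<in> space P \<Longrightarrow> invertible_mat (gram X (M \<omega>))"
    and alpha: "0 < \<alpha>" "\<alpha> < 1"
  defines "F \<equiv> generated_by P fY vec_borel"
  shows
    "(\<forall>m\<subseteq>{..<p}. invertible_mat (gram X m) \<longrightarrow>
        (\<forall>y\<in>carrier_vec n. beta_hat X m y = ls_solution X m y) \<and>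
        beta_star P Y X m = ls_solution X m \<mu>) \<and>
     (\<exists>\<kappa>. regular_cond_law P F (\<lambda>\<omega>. beta_hat X (M \<omega>) (gY \<omega>)) vec_borel \<kappa> \<and>
        (\<forall>\<omega>\<in>space P. mvn_law (card (M \<omega>)) (\<kappa> \<omega>)
           (beta_star P Y X (M \<omega>)) (fission_var X (M \<omega>) Sigma \<tau>))) \<and>
     (\<forall>k. let
        c = (\<lambda>\<omega>. beta_hat X (M \<omega>) (gY \<omega>) $ k);
        h = (\<lambda>\<omega>. normal_upper_quantile (\<alpha> / 2) * sqrt (fission_var X (M \<omega>) Sigma \<tau> $$ (k, k)));
        covered = {\<omega> \<in> space P. k < card (M \<omega>) \<and>
          beta_star P Y X (M \<omega>) $ k \<in> {c \<omega> - h \<omega> .. c \<omega> + h \<omega>}}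
      in covered \<in> sets P \<and>
         (AE \<omega> in P. k < card (M \<omega>) \<longrightarrow>
            cond_probability P F covered \<omega> \<ge> 1 - \<alpha> \<and>
            (fission_var X (M \<omega>) Sigma \<tau> $$ (k, k) > 0 \<longrightarrow>
               cond_probability P F covered \<omega> = 1 - \<alpha>))) \<and>
     (pos_def_mat n Sigma \<longrightarrow>
        (\<forall>\<omega>\<in>space P. \<forall>k<card (M \<omega>). fission_var X (M \<omega>) Sigma \<tau> $$ (k, k) > 0))"
proof -
  interpret data_fission P n Sigma \<mu> \<epsilon> Y Z fY gY \<tau>
    unfolding data_fission_def data_fission_axioms_def
    using prob mu Sigma eps Y Z indep tau fY gY by blast
  \<comment> \<open>\<open>I\<close> contains every model that can be selected; its finiteness is
    what \<open>cond_probability_selection\<close> asks for.\<close>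
  define I where "I = {m. m \<subseteq> {..<p} \<and> invertible_mat (gram X m)}"
  have finI: "finite I" unfolding I_def by simp
  have full: "full_rank_selection X n p m" if "m \<in> I" for m
    using that X by (auto simp: I_def full_rank_selection_def)
  have hat: "beta_hat X m y = ls_solution X m y" if "m \<in> I" "y \<in> carrier_vec n" for m y
    using full_rank_selection.beta_hat_eq[OF full[OF that(1)] that(2)] .
  have star: "beta_star P Y X m = ls_solution X m \<mu>" if "m \<in> I" for m
    using beta_star_eq[OF full[OF that]] .
  have fY_carrier: "fY \<omega> \<in> carrier_vec n" and gY_carrier: "gY \<omega> \<in> carrier_vec n" if "\<omega> \<in> space P" for \<omega>
    using random_vec_carrier[OF fY_random that] random_vec_carrier[OF gY_random that] .
  have sel: "select (fY \<omega>) \<in> I" if "\<omega> \<in> space P" for \<omega>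
    using measurable_space[OF select, of "fY \<omega>"] invertible[OF that] by (auto simp: I_def M)
  have sel_sets: "select -` {m} \<inter> space vec_borel \<in> sets vec_borel" if "m \<in> I" for m
    using that by (intro measurable_sets[OF select]) (auto simp: I_def)
  \<comment> \<open>Both the conditional law and the coverage are instances of this, for suitable
    families \<open>D\<close> of events about g indexed by the model.\<close>
  have cond: "{\<omega> \<in> space P. gY \<omega> \<in> D (M \<omega>)} \<in> sets P"
      "AE \<omega> in P. cond_probability P F {\<omega> \<in> space P. gY \<omega> \<in> D (M \<omega>)} \<omega> = prob (gY -` D (M \<omega>) \<inter> space P)"
    if D: "\<And>m. D m \<in> sets vec_borel" for D :: "nat set \<Rightarrow> real vec set"
    unfolding F_def M by ((rule cond_probability_selection[OF fission_indep sel finI sel_sets D]; assumption)+)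
  note ls_meas = measurable_ls_solution[of X]

  \<comment> \<open>Conditional law of the estimator\<close>
  define K where "K m = distr P vec_borel (\<lambda>\<omega>. ls_solution X m (gY \<omega>))" for m
  have gls: "(\<lambda>\<omega>. ls_solution X m (gY \<omega>)) \<in> measurable P vec_borel" for m
    using measurable_compose[OF random_vec_measurable[OF gY_random] ls_meas] .
  have preimage: "ls_solution X m -` B \<in> sets vec_borel" if "B \<in> sets vec_borel" for m B
    using measurable_sets[OF ls_meas that] by simp
  \<comment> \<open>This puts events about the estimator in the random model into the form required
    by \<open>cond\<close>.\<close>
  have W_preimage: "(\<lambda>\<omega>. beta_hat X (M \<omega>) (gY \<omega>)) -` B \<inter> space P =
      {\<omega> \<in> space P. gY \<omega> \<in> ls_solution X (M \<omega>) -` B}" for B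
    using hat[OF sel gY_carrier] unfolding M by auto
  have W: "(\<lambda>\<omega>. beta_hat X (M \<omega>) (gY \<omega>)) \<in> measurable P vec_borel"
  proof (rule measurableI)
    fix B :: "real vec set" assume B: "B \<in> sets vec_borel"
    show "(\<lambda>\<omega>. beta_hat X (M \<omega>) (gY \<omega>)) -` B \<inter> space P \<in> sets P"
      unfolding W_preimage by (rule cond(1)[OF preimage[OF B]])
  qed simp
  \<comment> \<open>The kernel is the unconditional law \<open>K m\<close> for a fixed model,
    evaluated at the selected one. Every map on a count space is measurable, so only
    \<open>select\<close> and \<open>fY\<close> matter.\<close>
  have kernel: "(\<lambda>\<omega>. K (M \<omega>)) \<in> measurable F (prob_algebra vec_borel)"
  proof -
    have f: "fY \<in> measurable F vec_borel"
      unfolding F_def generated_by_def by (rule measurable_vimage_algebra1) simp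
    have k: "K \<in> measurable (count_space (Pow {..<p})) (prob_algebra vec_borel)"
      unfolding measurable_count_space_eq1
      by (rule Pi_I) (simp add: K_def space_prob_algebra prob_space_distr[OF gls])
    show ?thesis
      unfolding M by (rule measurable_compose[OF f measurable_compose[OF select k]])
  qed
  have regular: "regular_cond_law P F (\<lambda>\<omega>. beta_hat X (M \<omega>) (gY \<omega>)) vec_borel (\<lambda>\<omega>. K (M \<omega>))"
    unfolding regular_cond_law_def
  proof (intro conjI W kernel ballI)
    fix B :: "real vec set" assume B: "B \<in> sets vec_borel"
    have "prob (gY -` (ls_solution X m -` B) \<inter> space P) = measure (K m) B" for m
      unfolding K_def measure_distr[OF gls B] by (rule arg_cong[where f = prob]) auto
    then show "AE \<omega> in P. cond_probability P F ((\<lambda>\<omega>. beta_hat X (M \<omega>) (gY \<omega>)) -` B \<inter> space P) \<omega> =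
        measure (K (M \<omega>)) B"
      unfolding W_preimage using cond(2)[OF preimage[OF B]] by simp
  qed
  have law: "mvn_law (card (M \<omega>)) (K (M \<omega>)) (beta_star P Y X (M \<omega>)) (fission_var X (M \<omega>) Sigma \<tau>)"
    if "\<omega> \<in> space P" for \<omega>
    using ls_solution_law(1)[OF full] star sel[OF that] by (simp add: K_def M)

  \<comment> \<open>Conditional coverage of the interval\<close>
  define h where "h m k = normal_upper_quantile (\<alpha> / 2) * sqrt (fission_var X m Sigma \<tau> $$ (k, k))" for m k
  define B where "B k m = {y. k < card m \<and> ls_solution X m \<mu> $ k \<in>
      {ls_solution X m y $ k - h m k..ls_solution X m y $ k + h m k}}" for k m
  have B_sets: "B k m \<in> sets vec_borel" for k m
  proof -
    have [measurable]: "(\<lambda>y. ls_solution X m y $ k) \<in> borel_measurable vec_borel"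
      using measurable_compose[OF ls_meas measurable_vec_index] .
    have "{y \<in> space vec_borel. k < card m \<and> ls_solution X m \<mu> $ k \<in>
      {ls_solution X m y $ k - h m k..ls_solution X m y $ k + h m k}} \<in> sets vec_borel"
      unfolding atLeastAtMost_iff by measurable
    then show ?thesis by (simp add: B_def)
  qed
  have covered_eq: "{\<omega> \<in> space P. k < card (M \<omega>) \<and> beta_star P Y X (M \<omega>) $ k \<in>
      {beta_hat X (M \<omega>) (gY \<omega>) $ k - h (M \<omega>) k..beta_hat X (M \<omega>) (gY \<omega>) $ k + h (M \<omega>) k}} =
      {\<omega> \<in> space P. gY \<omega> \<in> B k (M \<omega>)}" for k
    using hat[OF sel gY_carrier] star[OF sel] unfolding M B_def by auto
  have B_prob: "prob (gY -` B k m \<inter> space P) = (if fission_var X m Sigma \<tau> $$ (k, k) = 0 then 1 else 1 - \<alpha>)"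
    if "m \<in> I" "k < card m" for k m
  proof -
    have "gY -` B k m \<inter> space P = {\<omega> \<in> space P. ls_solution X m \<mu> $ k \<in>
        {ls_solution X m (gY \<omega>) $ k - h m k..ls_solution X m (gY \<omega>) $ k + h m k}}"
      using that(2) by (auto simp: B_def)
    then show ?thesis
      using ls_interval_coverage[OF full[OF that(1)] alpha that(2)] by (simp only: h_def)
  qed
  have coverage: "AE \<omega> in P. k < card (M \<omega>) \<longrightarrow>
      cond_probability P F {\<omega> \<in> space P. gY \<omega> \<in> B k (M \<omega>)} \<omega> \<ge> 1 - \<alpha> \<and>
      (fission_var X (M \<omega>) Sigma \<tau> $$ (k, k) > 0 \<longrightarrow>
        cond_probability P F {\<omega> \<in> space P. gY \<omega> \<in> B k (M \<omega>)} \<omega> = 1 - \<alpha>)" for k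
  proof -
    have "AE \<omega> in P. cond_probability P F {\<omega> \<in> space P. gY \<omega> \<in> B k (M \<omega>)} \<omega> =
        prob (gY -` B k (M \<omega>) \<inter> space P)"
      by (rule cond(2)[OF B_sets])
    then show ?thesis
      using AE_space
    proof eventually_elim
      case (elim \<omega>)
      then show ?case using B_prob[OF sel[OF elim(2)]] alpha by (auto simp: M)
    qed
  qed
  have covered_sets: "{\<omega> \<in> space P. gY \<omega> \<in> B k (M \<omega>)} \<in> sets P" for k
    by (rule cond(1)[OF B_sets])
  have pos: "0 < fission_var X (M \<omega>) Sigma \<tau> $$ (k, k)"
    if "pos_def_mat n Sigma" "\<omega> \<in> space P" "k < card (M \<omega>)" for \<omega> k
  proof -
    have "fission_covariance X n p (M \<omega>) Sigma"
      using full[OF sel[OF that(2)]] Sigma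
      by (simp add: fission_covariance_def fission_covariance_axioms_def M)
    then show ?thesis using fission_covariance.fission_var_diag_pos that by blast
  qed
  show ?thesis
    unfolding Let_def h_def[symmetric] covered_eq
    using hat star regular law covered_sets coverage pos by (auto simp: I_def)
qed

end
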